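(* Let $G$ be a 2-connected simple graph. Then $G$ satisfies $(\spadesuit)_2$ if and only if $G$ can be obtained from copies of the complete graph $K_4$ by repeatedly applying collisions.
   Context: A graph is 2-connected if connected, with at least two vertices and no cut vertex (a single edge counts as 2-connected). A 2-connected simple graph $H=(V,E)$ satisfies $(\spadesuit)_2$ if $|E|=2(|V|-1)$ and $|E(S)|=2|S|-3$ for every good flat $S\subset V$, where $E(S)$ is the set of edges with both ends in $S$ and $S$ is a good flat if $H|_S$ is 2-connected and the graph obtained from $H$ by contracting all edges of $E(S)$ is 2-connected. The collision of graphs $G_1,G_2$ on edges $e_1\in E(G_1)$, $e_2\in E(G_2)$ is obtained by gluing $G_1$ and $G_2$ along $e_1,e_2$ (identifying these edges and their endpoints) and then removing the identified edge. "Obtained by repeatedly applying collisions" means belonging to the smallest class containing $K_4$ and closed under collision of two members. *)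

theory Defs
  imports Main
begin

text \<open>
  Contracting edges of a simple graph may create parallel edges, so graphs are multigraphs:
  \<open>ends G e\<close> is the set of end vertices of the edge \<open>e\<close> (a singleton if \<open>e\<close> is a loop).
  A simple graph is a finite multigraph each of whose edges is itself a two-element set of
  vertices, namely its own set of ends.
\<close>

record ('v, 'e) multigraph =
  verts :: "'v set"
  edges :: "'e set"
  ends :: "'e \<Rightarrow> 'v set"

definition simple_graph :: "('v, 'v set) multigraph \<Rightarrow> bool" where
  "simple_graph G \<longleftrightarrow> finite (verts G) \<and> ends G = (\<lambda>e. e) \<and>
     (\<forall>e\<in>edges G. e \<subseteq> verts G \<and> card e = 2)"

definition adj :: "('v, 'e) multigraph \<Rightarrow> ('v \<times> 'v) set" where
  "adj G = {(u, v). \<exists>e\<in>edges G. ends G e = {u, v}}"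

definition connected_graph :: "('v, 'e) multigraph \<Rightarrow> bool" where
  "connected_graph G \<longleftrightarrow> (\<forall>u\<in>verts G. \<forall>v\<in>verts G. (u, v) \<in> (adj G)\<^sup>*)"

text \<open>\<open>edges_in G S\<close> is the set \<open>E(S)\<close>; \<open>induced G S\<close> is the restriction of \<open>G\<close> to \<open>S\<close>.\<close>

definition edges_in :: "('v, 'e) multigraph \<Rightarrow> 'v set \<Rightarrow> 'e set" where
  "edges_in G S = {e \<in> edges G. ends G e \<subseteq> S}"

definition induced :: "('v, 'e) multigraph \<Rightarrow> 'v set \<Rightarrow> ('v, 'e) multigraph" where
  "induced G S = \<lparr>verts = S, edges = edges_in G S, ends = ends G\<rparr>"

definition cut_vertex :: "('v, 'e) multigraph \<Rightarrow> 'v \<Rightarrow> bool" where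
  "cut_vertex G v \<longleftrightarrow> v \<in> verts G \<and> \<not> connected_graph (induced G (verts G - {v}))"

definition two_connected :: "('v, 'e) multigraph \<Rightarrow> bool" where
  "two_connected G \<longleftrightarrow> connected_graph G \<and> card (verts G) \<ge> 2 \<and> (\<nexists>v. cut_vertex G v)"

text \<open>
  Contraction of a set \<open>F\<close> of edges: the new vertices are the connected components of the
  spanning subgraph with edge set \<open>F\<close>; the remaining edges are kept, including any that
  become parallel (or loops).
\<close>

definition component :: "('v, 'e) multigraph \<Rightarrow> 'e set \<Rightarrow> 'v \<Rightarrow> 'v set" where
  "component G F v = (adj \<lparr>verts = verts G, edges = F, ends = ends G\<rparr>)\<^sup>* `` {v}"

definition contract :: "('v, 'e) multigraph \<Rightarrow> 'e set \<Rightarrow> ('v set, 'e) multigraph" where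
  "contract G F = \<lparr>verts = component G F ` verts G, edges = edges G - F,
     ends = (\<lambda>e. component G F ` ends G e)\<rparr>"

definition good_flat :: "('v, 'e) multigraph \<Rightarrow> 'v set \<Rightarrow> bool" where
  "good_flat G S \<longleftrightarrow> S \<subset> verts G \<and> two_connected (induced G S) \<and>
     two_connected (contract G (edges_in G S))"

definition spade2 :: "('v, 'e) multigraph \<Rightarrow> bool" where
  "spade2 G \<longleftrightarrow> int (card (edges G)) = 2 * (int (card (verts G)) - 1) \<and>
     (\<forall>S. good_flat G S \<longrightarrow> int (card (edges_in G S)) = 2 * int (card S) - 3)"

definition isomorphic :: "('v, 'v set) multigraph \<Rightarrow> ('w, 'w set) multigraph \<Rightarrow> bool" where
  "isomorphic G H \<longleftrightarrow>
     (\<exists>f. bij_betw f (verts G) (verts H) \<and> edges H = (\<lambda>e. f ` e) ` edges G)"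

text \<open>
  \<open>is_collision G1 e1 G2 e2 G\<close>: the simple graph \<open>G\<close> is (a copy of) a collision of the simple
  graphs \<open>G1\<close> and \<open>G2\<close> on \<open>e1\<close> and \<open>e2\<close>.  The injections \<open>f1\<close> and \<open>f2\<close> are the maps into
  the glued graph, whose images meet exactly in the ends of the identified edge.  The edges
  can be identified in two ways; both results count as collisions.
\<close>

definition is_collision ::
  "('v, 'v set) multigraph \<Rightarrow> 'v set \<Rightarrow> ('w, 'w set) multigraph \<Rightarrow> 'w set \<Rightarrow>
   ('u, 'u set) multigraph \<Rightarrow> bool" where
  "is_collision G1 e1 G2 e2 G \<longleftrightarrow> e1 \<in> edges G1 \<and> e2 \<in> edges G2 \<and>
     (\<exists>f1 f2. inj_on f1 (verts G1) \<and> inj_on f2 (verts G2) \<and>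
        f1 ` e1 = f2 ` e2 \<and>
        f1 ` verts G1 \<inter> f2 ` verts G2 = f1 ` e1 \<and>
        verts G = f1 ` verts G1 \<union> f2 ` verts G2 \<and>
        edges G = ((\<lambda>e. f1 ` e) ` edges G1 \<union> (\<lambda>e. f2 ` e) ` edges G2) - {f1 ` e1} \<and>
        ends G = (\<lambda>e. e))"

definition K4 :: "(nat, nat set) multigraph" where
  "K4 = \<lparr>verts = {0..<4}, edges = {e. e \<subseteq> {0..<4} \<and> card e = 2}, ends = (\<lambda>e. e)\<rparr>"

text \<open>
  Since \<^typ>\<open>nat\<close> is infinite, every finite simple graph, and every collision of two of them,
  has a copy with vertices in \<^typ>\<open>nat\<close>.
\<close>

inductive K4_collisions :: "(nat, nat set) multigraph \<Rightarrow> bool" where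
  K4: "K4_collisions K4"
| collision: "K4_collisions G1 \<Longrightarrow> K4_collisions G2 \<Longrightarrow> is_collision G1 e1 G2 e2 G \<Longrightarrow>
    K4_collisions G"

definition obtainable_from_K4 :: "('v, 'v set) multigraph \<Rightarrow> bool" where
  "obtainable_from_K4 G \<longleftrightarrow> (\<exists>H. K4_collisions H \<and> isomorphic H G)"

end

theory Submission
  imports Defs
begin

text \<open>
  For a 2-connected graph on \<open>n\<close> vertices, \<open>S\<close> is a good flat iff it is proper, \<open>G|S\<close> is
  2-connected and \<open>G - S\<close> is connected.  Under spade, a proper set \<open>T\<close> attached to the rest of
  the graph at two of its vertices only spans at most \<open>2|T| - 3\<close> edges, with equality only if
  \<open>G|T\<close> is 2-connected: a \<open>T\<close> with connected complement is either a good flat or splits at a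
  cut vertex into two smaller such sets, and a disconnected complement is handled by inclusion and
  exclusion.  The two sides \<open>A\<close>, \<open>B\<close> of a two-vertex cut \<open>{a, b}\<close> satisfy
  \<open>|A| + |B| = n + 2\<close>, so \<open>|E| = 2(n - 1)\<close> forces equality for both and \<open>ab\<close> to be a
  non-edge.  Hence \<open>G\<close> is the collision of \<open>G|A + ab\<close> and \<open>G|B + ab\<close>, which inherit spade.
  If there is no two-vertex cut, every \<open>V - v\<close> is a good flat, so \<open>G\<close> is cubic and
  \<open>3n = 2(2n - 2)\<close> leaves only the complete graph on four vertices.  Conversely, good flats of
  a collision restrict to good flats of the summands.
\<close>

section \<open>Connectivity of vertex sets\<close>

text \<open>Connectivity is stated through cuts rather than walks: a failure then hands over the
  separating set \<open>X\<close> directly, which is how disconnection is used below. The empty set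
  counts as connected, as it does for \<open>connected_graph\<close>.\<close>

definition connected_on :: "'a set set \<Rightarrow> 'a set \<Rightarrow> bool" where
  "connected_on E S \<longleftrightarrow> (\<forall>X\<subseteq>S. X \<noteq> {} \<longrightarrow> X \<noteq> S \<longrightarrow> (\<exists>x\<in>X. \<exists>y\<in>S - X. {x, y} \<in> E))"

definition biconnected_on :: "'a set set \<Rightarrow> 'a set \<Rightarrow> bool" where
  "biconnected_on E S \<longleftrightarrow> card S \<ge> 2 \<and> connected_on E S \<and> (\<forall>v\<in>S. connected_on E (S - {v}))"

definition edges_on :: "'a set set \<Rightarrow> 'a set \<Rightarrow> 'a set set" where
  "edges_on E S = {e \<in> E. e \<subseteq> S}"

text \<open>Contracting the connected set \<open>S\<close> turns it into one vertex, and in a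
  2-connected graph only that vertex can become a cut vertex of the contraction. The contraction
  condition thus reduces to connectedness of \<open>V - S\<close>; see
  \<open>two_connected_contract\<close>.\<close>

definition good_on :: "'a set set \<Rightarrow> 'a set \<Rightarrow> 'a set \<Rightarrow> bool" where
  "good_on E V S \<longleftrightarrow> S \<subset> V \<and> biconnected_on E S \<and> connected_on E (V - S)"

text \<open>The subtractions of \<open>spade2\<close> are moved across, so that both counts live in
  the natural numbers.\<close>

definition spade_on :: "'a set set \<Rightarrow> 'a set \<Rightarrow> bool" where
  "spade_on E V \<longleftrightarrow> card E + 2 = 2 * card V \<and>
     (\<forall>S. good_on E V S \<longrightarrow> card (edges_on E S) + 3 = 2 * card S)"

lemma connected_onD:
  assumes "connected_on E S" "X \<subseteq> S" "X \<noteq> {}" "X \<noteq> S"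
  obtains x y where "x \<in> X" "y \<in> S" "y \<notin> X" "{x, y} \<in> E"
  using assms unfolding connected_on_def by blast

text \<open>A cut of \<open>S\<close> either splits the connected core \<open>B\<close>, and is
  crossed inside \<open>B\<close>, or leaves \<open>B\<close> on one side. In the latter case the
  other side is a set avoiding \<open>B\<close>, to which the last hypothesis applies.\<close>

lemma connected_onI_extend:
  assumes B: "connected_on E B" "B \<subseteq> S" "B \<noteq> {}"
    and step: "\<And>Y. Y \<subseteq> S - B \<Longrightarrow> Y \<noteq> {} \<Longrightarrow> \<exists>x\<in>Y. \<exists>y\<in>S - Y. {x, y} \<in> E"
  shows "connected_on E S"
  unfolding connected_on_def
proof (intro allI impI)
  fix X assume X: "X \<subseteq> S" "X \<noteq> {}" "X \<noteq> S"
  consider "B \<subseteq> X" | "B \<inter> X = {}" | "B \<inter> X \<noteq> {}" "B \<inter> X \<noteq> B" by blast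
  then show "\<exists>x\<in>X. \<exists>y\<in>S - X. {x, y} \<in> E"
  proof cases
    case 1
    then have "\<exists>x\<in>S - X. \<exists>y\<in>S - (S - X). {x, y} \<in> E" using step[of "S - X"] X by blast
    then obtain x y where "x \<in> S - X" "y \<in> X" "{x, y} \<in> E" by blast
    then show ?thesis by (metis insert_commute)
  next
    case 2
    then show ?thesis using step[of X] X by blast
  next
    case 3
    with B show ?thesis by (blast elim: connected_onD[of E B "B \<inter> X"])
  qed
qed

lemma connected_on_singleton [simp]: "connected_on E {v}"
  unfolding connected_on_def by blast

lemma connected_on_mono: "connected_on E S \<Longrightarrow> edges_on E S \<subseteq> F \<Longrightarrow> connected_on F S"
  unfolding connected_on_def edges_on_def by (simp add: subset_iff) (smt (verit) DiffD1 insert_iff singletonD)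

lemma biconnected_on_mono: "biconnected_on E S \<Longrightarrow> edges_on E S \<subseteq> F \<Longrightarrow> biconnected_on F S"
proof -
  assume *: "biconnected_on E S" "edges_on E S \<subseteq> F"
  then have "edges_on E (S - {v}) \<subseteq> F" for v unfolding edges_on_def by blast
  with * show ?thesis unfolding biconnected_on_def by (blast intro: connected_on_mono)
qed

text \<open>The last hypothesis says that \<open>S - T\<close> has at most one element. This form
  spares case splits when two given vertices are deleted of which at most one lies in
  \<open>S\<close>.\<close>

lemma biconnected_onD_less:
  "biconnected_on E S \<Longrightarrow> T \<subseteq> S \<Longrightarrow> \<forall>x\<in>S - T. \<forall>y\<in>S - T. x = y \<Longrightarrow> connected_on E T"
proof (cases "T = S")
  case False
  assume *: "biconnected_on E S" "T \<subseteq> S" "\<forall>x\<in>S - T. \<forall>y\<in>S - T. x = y"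
  then obtain v where "v \<in> S" "T = S - {v}" using False by blast
  with * show ?thesis unfolding biconnected_on_def by blast
qed (auto simp: biconnected_on_def)

text \<open>The edge \<open>{a, b}\<close>, possibly missing from \<open>E\<close>, is replaced by
  the connected set \<open>B\<close>. Those of its ends that lie in \<open>S\<close> belong to
  \<open>B\<close>, so a subset of \<open>S - B\<close> contains neither, and an edge of
  \<open>E1\<close> leaving it is an edge of \<open>E\<close>.\<close>

lemma connected_subst:
  assumes "connected_on E1 S" "connected_on E B" "S \<inter> B \<noteq> {}"
    and "E1 \<subseteq> insert {a, b} E" "{a, b} \<inter> S \<subseteq> B"
  shows "connected_on E (S \<union> B)"
proof (rule connected_onI_extend[of _ B])
  fix Y assume Y: "Y \<subseteq> S \<union> B - B" "Y \<noteq> {}"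
  then obtain x y where xy: "x \<in> Y" "y \<in> S" "y \<notin> Y" "{x, y} \<in> E1"
    using assms(1,3) by (blast elim: connected_onD[of E1 S Y])
  then have "{x, y} \<noteq> {a, b}" using Y assms(5) by (auto simp: doubleton_eq_iff)
  with xy assms(4) show "\<exists>x\<in>Y. \<exists>y\<in>S \<union> B - Y. {x, y} \<in> E" by blast
qed (use assms in auto)

lemma card_2E:
  assumes "card e = 2" obtains x y where "e = {x, y}" "x \<noteq> y"
  using assms by (auto simp: card_2_iff)

section \<open>Finite simple graphs\<close>

locale sgraph =
  fixes V :: "'a set" and E :: "'a set set"
  assumes finite_V: "finite V" and edge_subset: "e \<in> E \<Longrightarrow> e \<subseteq> V"
    and edge_card: "e \<in> E \<Longrightarrow> card e = 2"
begin

lemma finite_E: "finite E"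
  using finite_V edge_subset by (meson finite_Pow_iff Pow_iff finite_subset subsetI)

lemma finite_edges_on [simp]: "finite (edges_on E S)"
  unfolding edges_on_def using finite_E by auto

lemma edges_on_V [simp]: "edges_on E V = E"
  unfolding edges_on_def using edge_subset by blast

lemma edgeE:
  assumes "e \<in> E" obtains x y where "e = {x, y}" "x \<noteq> y" "x \<in> V" "y \<in> V" "{x, y} \<in> E" "{y, x} \<in> E"
  using assms edge_card edge_subset by (metis card_2E insert_commute insert_subset)

lemma card_E_le: "card E \<le> card V choose 2"
proof -
  have "E \<subseteq> {e. e \<subseteq> V \<and> card e = 2}" using edge_subset edge_card by blast
  then show ?thesis
    using n_subsets[OF finite_V, of 2] card_mono[of "{e. e \<subseteq> V \<and> card e = 2}" E] finite_V
    by simp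
qed

text \<open>Two vertices would have to carry two edges but carry at most one. This excludes a single
  edge as a summand, whose deletion would disconnect its side.\<close>

lemma spade_card_ge_3:
  assumes "spade_on E V" "card V \<ge> 2" shows "card V \<ge> 3"
proof (rule ccontr)
  assume "\<not> ?thesis"
  with assms have "card V = 2" by simp
  with card_E_le assms show False unfolding spade_on_def by simp
qed

end

section \<open>Vertex sets with at most two attachments\<close>

locale spade_graph = sgraph +
  assumes bicon: "biconnected_on E V" and spade: "spade_on E V"
begin

text \<open>All edges leaving \<open>Y\<close> would end in \<open>x\<close>, so \<open>x\<close>
  would be a cut vertex separating \<open>Y\<close> from the rest.\<close>

lemma no_private_part:
  assumes "Y \<subseteq> V" "Y \<noteq> {}" "Y \<noteq> V - {x}" "x \<notin> Y"
    "\<And>y z. y \<in> Y \<Longrightarrow> z \<in> V - Y \<Longrightarrow> {y, z} \<in> E \<Longrightarrow> z = x"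
  shows False
proof -
  have "connected_on E (V - {x})" using bicon by (cases "x \<in> V") (auto simp: biconnected_on_def)
  then show False using assms by (blast elim: connected_onD[of E "V - {x}" Y])
qed

text \<open>The set in question is \<open>V - T\<close> together with \<open>Q\<close>. Suppose some
  \<open>Y\<close> inside \<open>Q\<close> has no edge to the rest of it. If \<open>b\<close> is not
  in \<open>Y\<close>, then \<open>Y\<close> is joined only to \<open>x\<close>; if \<open>b\<close>
  is in \<open>Y\<close>, then \<open>V - T\<close> is joined to \<open>T\<close> only at
  \<open>a\<close>. Either way there is a cut vertex.\<close>

lemma connected_complement:
  assumes T: "T \<subset> V" "a \<in> T" "b \<in> T" "a \<noteq> b"
    and bd: "\<And>y z. y \<in> T \<Longrightarrow> z \<in> V - T \<Longrightarrow> {y, z} \<in> E \<Longrightarrow> y = a \<or> y = b"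
    and co: "connected_on E (V - T)"
    and x: "x \<in> T" "T - {x} = P \<union> Q" "P \<inter> Q = {}" "a \<in> P" "b \<in> Q"
    and nc: "\<And>p q. p \<in> P \<Longrightarrow> q \<in> Q \<Longrightarrow> {p, q} \<notin> E"
  shows "connected_on E (V - (P \<union> {x}))"
proof (rule connected_onI_extend[OF co])
  show "V - T \<subseteq> V - (P \<union> {x})" using x by blast
  show "V - T \<noteq> {}" using T by blast
  fix Y assume Y: "Y \<subseteq> V - (P \<union> {x}) - (V - T)" "Y \<noteq> {}"
  have YQ: "Y \<subseteq> Q" using Y x by blast
  show "\<exists>u\<in>Y. \<exists>v\<in>V - (P \<union> {x}) - Y. {u, v} \<in> E"
  proof (rule ccontr)
    assume none: "\<not> ?thesis"
    show False
    proof (cases "b \<in> Y")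
      case False
      show False
      proof (rule no_private_part[of Y x])
        fix u v assume "u \<in> Y" "v \<in> V - Y" "{u, v} \<in> E"
        moreover from this have "v \<notin> P" using nc[of v u] YQ by (auto simp: insert_commute)
        ultimately show "v = x" using none by blast
      qed (use Y YQ x T in auto)
    next
      case True
      show False
      proof (rule no_private_part[of "V - T" a])
        fix u v assume *: "u \<in> V - T" "v \<in> V - (V - T)" "{u, v} \<in> E"
        then have "v = a \<or> v = b" using bd[of v u] by (auto simp: insert_commute)
        moreover have "u \<in> V - (P \<union> {x}) - Y" using * x Y by blast
        then have "{b, u} \<notin> E" using none True by blast
        ultimately show "v = a" using * by (auto simp: insert_commute)
      qed (use T in auto)
    qed
  qed
qed

text \<open>Induction on the size of \<open>T\<close>. A biconnected \<open>T\<close> is a good flat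
  and has equality. A disconnected \<open>T\<close> is the non-adjacent pair \<open>{a, b}\<close>,
  where 0 + 3 < 4. If \<open>x\<close> cuts \<open>T\<close>, the two sides with \<open>x\<close>
  added have sizes summing to \<open>card T + 1\<close>, so \<open>T\<close> spans at most 2 (|T| +
  1) - 6 edges, one below the bound. Equality thus occurs only in the biconnected case.\<close>

lemma bound_connected_complement:
  assumes "T \<subset> V" "a \<in> T" "b \<in> T" "a \<noteq> b"
    and "\<And>y z. y \<in> T \<Longrightarrow> z \<in> V - T \<Longrightarrow> {y, z} \<in> E \<Longrightarrow> y = a \<or> y = b"
    and "connected_on E (V - T)"
  shows "card (edges_on E T) + 3 \<le> 2 * card T \<and>
    (card (edges_on E T) + 3 = 2 * card T \<longrightarrow> biconnected_on E T)"
  using assms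
proof (induction "card T" arbitrary: T a b rule: less_induct)
  case less
  note T = less.prems(1-4) and bd = less.prems(5) and co = less.prems(6)
  have fin: "finite T" using T finite_V finite_subset by blast
  have card2: "card T \<ge> 2" using T fin by (metis card_le_Suc0_iff_eq not_less_eq_eq numeral_2_eq_2)
  \<comment> \<open>A part of \<open>T\<close> avoiding both attachment vertices has no edges out of
    \<open>T\<close>. If inside \<open>T\<close> it is joined only to \<open>x\<close>, then
    \<open>x\<close> is a cut vertex of the whole graph.\<close>
  have no_cut: False
    if "Y \<subseteq> T" "Y \<noteq> {}" "x \<in> T" "x \<notin> Y" "a \<notin> Y" "b \<notin> Y"
      "\<And>u v. u \<in> Y \<Longrightarrow> v \<in> T - {x} - Y \<Longrightarrow> {u, v} \<notin> E" for x Y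
  proof (rule no_private_part[of Y x])
    fix u v assume *: "u \<in> Y" "v \<in> V - Y" "{u, v} \<in> E"
    then have "v \<in> T" using bd[of u v] that by blast
    then show "v = x" using * that(7)[of u v] by blast
  qed (use that T in auto)
  show ?case
  proof (cases "biconnected_on E T")
    case True
    then have "good_on E V T" using T co unfolding good_on_def by blast
    then show ?thesis using spade True unfolding spade_on_def by auto
  next
    case False
    have "card (edges_on E T) + 3 < 2 * card T"
    proof (cases "connected_on E T")
      case False
      then obtain X where X: "X \<subseteq> T" "X \<noteq> {}" "X \<noteq> T"
        and nc: "\<And>u v. u \<in> X \<Longrightarrow> v \<in> T - X \<Longrightarrow> {u, v} \<notin> E"
        unfolding connected_on_def by blast
      have nc': "\<And>u v. u \<in> T - X \<Longrightarrow> v \<in> X \<Longrightarrow> {u, v} \<notin> E" using nc by (metis insert_commute)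
      have ab: "(a \<in> X) \<noteq> (b \<in> X)"
      proof
        assume "(a \<in> X) = (b \<in> X)"
        then consider "a \<in> X" "b \<in> X" | "a \<notin> X" "b \<notin> X" by blast
        then show False
        proof cases
          case 1 then show False using no_cut[of "T - X" a] X T nc' by blast
        next
          case 2 then show False using no_cut[of X a] X T nc by blast
        qed
      qed
      \<comment> \<open>A third vertex would lie on one side of the split. That side without
        \<open>a\<close> and \<open>b\<close> would then be cut off by whichever of
        \<open>a\<close>, \<open>b\<close> it contains.\<close>
      have "\<forall>u\<in>T. u = a \<or> u = b"
      proof (rule ccontr)
        assume "\<not> ?thesis"
        then obtain u where u: "u \<in> T" "u \<noteq> a" "u \<noteq> b" by blast
        show False
        proof (cases "u \<in> X")
          case True
          then show False
            using no_cut[of "X - {a, b}" a] no_cut[of "X - {a, b}" b] X T u ab nc by blast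
        next
          case False
          then show False
            using no_cut[of "T - X - {a, b}" a] no_cut[of "T - X - {a, b}" b] X T u ab nc' by blast
        qed
      qed
      then have TT: "T = {a, b}" using T by blast
      have "{a, b} \<notin> E" using ab nc[of a b] nc'[of a b] T by blast
      have "edges_on E T = {}"
      proof (rule equals0I)
        fix e assume "e \<in> edges_on E T"
        then have e: "e \<in> E" "e \<subseteq> {a, b}" unfolding edges_on_def TT by auto
        then obtain u v where "e = {u, v}" "u \<noteq> v" by (auto elim: edgeE)
        with e have "e = {a, b}" by auto
        with e \<open>{a, b} \<notin> E\<close> show False by blast
      qed
      then show ?thesis using T TT by simp
    next
      case True
      then obtain x where x: "x \<in> T" and "\<not> connected_on E (T - {x})"
        using False card2 unfolding biconnected_on_def by blast
      then obtain X where X: "X \<subseteq> T - {x}" "X \<noteq> {}" "X \<noteq> T - {x}"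
        and nc: "\<And>u v. u \<in> X \<Longrightarrow> v \<in> T - {x} - X \<Longrightarrow> {u, v} \<notin> E"
        unfolding connected_on_def by blast
      have nc': "\<And>u v. u \<in> T - {x} - X \<Longrightarrow> v \<in> X \<Longrightarrow> {u, v} \<notin> E"
        using nc by (metis insert_commute)
      \<comment> \<open>Each side of the cut at \<open>x\<close> contains an attachment vertex, as
        otherwise \<open>x\<close> would cut it off in the whole graph. Hence \<open>a\<close> and
        \<open>b\<close> lie on opposite sides and both differ from \<open>x\<close>.\<close>
      have 1: "a \<in> X \<or> b \<in> X" using no_cut[of X x] X x nc by blast
      have 2: "a \<in> T - {x} - X \<or> b \<in> T - {x} - X"
        using no_cut[of "T - {x} - X" x] X x nc' by blast
      obtain P Q where PQ: "T - {x} = P \<union> Q" "P \<inter> Q = {}" "a \<in> P" "b \<in> Q"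
        and ncPQ: "\<And>p q. p \<in> P \<Longrightarrow> q \<in> Q \<Longrightarrow> {p, q} \<notin> E"
      proof (cases "a \<in> X")
        case True
        with 2 X nc that[of X "T - {x} - X"] show ?thesis by blast
      next
        case False
        with 1 2 X nc' that[of "T - {x} - X" X] show ?thesis by blast
      qed
      have ncQP: "\<And>p q. p \<in> Q \<Longrightarrow> q \<in> P \<Longrightarrow> {p, q} \<notin> E" using ncPQ by (metis insert_commute)
      have bd': "\<And>y z. y \<in> T \<Longrightarrow> z \<in> V - T \<Longrightarrow> {y, z} \<in> E \<Longrightarrow> y = b \<or> y = a"
        using bd by blast
      have xne: "x \<noteq> a" "x \<noteq> b" "x \<notin> P" "x \<notin> Q" using PQ by blast+
      have finPQ: "finite P" "finite Q" using PQ fin by (metis finite_Diff finite_Un)+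
      have cardT: "card T = Suc (card P + card Q)"
        using PQ x finPQ fin by (metis card.remove card_Un_disjoint)
      have pos: "card P > 0" "card Q > 0" using PQ finPQ by (auto simp: card_gt_0_iff)
      \<comment> \<open>With no edges from \<open>P\<close> to \<open>Q\<close>, the set
        \<open>P \<union> {x}\<close> is attached only at \<open>a\<close> and \<open>x\<close>, so
        the induction hypothesis applies with this new pair.\<close>
      have b1: "card (edges_on E (P \<union> {x})) + 3 \<le> 2 * card (P \<union> {x})"
      proof (rule less.hyps[THEN conjunct1, of _ a x])
        show "card (P \<union> {x}) < card T" using cardT pos finPQ xne by simp
        show "connected_on E (V - (P \<union> {x}))"
          by (rule connected_complement[OF T bd co x PQ ncPQ])
        fix y z assume "y \<in> P \<union> {x}" "z \<in> V - (P \<union> {x})" "{y, z} \<in> E"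
        then show "y = a \<or> y = x" using PQ T x ncPQ[of y z] bd[of y z] by blast
      qed (use PQ T x xne in auto)
      have b2: "card (edges_on E (Q \<union> {x})) + 3 \<le> 2 * card (Q \<union> {x})"
      proof (rule less.hyps[THEN conjunct1, of _ b x])
        show "card (Q \<union> {x}) < card T" using cardT pos finPQ xne by simp
        show "connected_on E (V - (Q \<union> {x}))"
          by (rule connected_complement[of T b a, OF _ _ _ _ bd' co x])
            (use PQ T ncQP in auto)
        fix y z assume "y \<in> Q \<union> {x}" "z \<in> V - (Q \<union> {x})" "{y, z} \<in> E"
        then show "y = b \<or> y = x" using PQ T x ncQP[of y z] bd[of y z] by blast
      qed (use PQ T x xne in auto)
      have "edges_on E T \<subseteq> edges_on E (P \<union> {x}) \<union> edges_on E (Q \<union> {x})"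
      proof
        fix e assume "e \<in> edges_on E T"
        then have e: "e \<in> E" "e \<subseteq> P \<union> Q \<union> {x}" using PQ x by (auto simp: edges_on_def)
        then obtain u v where "e = {u, v}" by (auto elim: edgeE)
        with e ncPQ ncQP show "e \<in> edges_on E (P \<union> {x}) \<union> edges_on E (Q \<union> {x})"
          unfolding edges_on_def by blast
      qed
      then have "card (edges_on E T) \<le> card (edges_on E (P \<union> {x})) + card (edges_on E (Q \<union> {x}))"
        by (meson card_Un_le card_mono finite_UnI finite_edges_on order_trans)
      then show ?thesis using b1 b2 cardT xne finPQ by simp
    qed
    then show ?thesis by simp
  qed
qed

text \<open>Every edge lies inside \<open>A\<close> or inside \<open>B\<close>, and inside both
  exactly when it lies in \<open>A \<inter> B\<close>.\<close>

lemma card_edges_on_separation: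
  assumes "A \<union> B = V" "\<And>u v. u \<in> A - B \<Longrightarrow> v \<in> B - A \<Longrightarrow> {u, v} \<notin> E"
  shows "card (edges_on E A) + card (edges_on E B) = card E + card (edges_on E (A \<inter> B))"
proof -
  have "e \<subseteq> A \<or> e \<subseteq> B" if "e \<in> E" for e
    using that assms edgeE[OF that] by (smt (verit) DiffI UnE insert_subset subsetI singletonD insertE)
  then have "edges_on E A \<union> edges_on E B = E" by (auto simp: edges_on_def)
  moreover have "edges_on E A \<inter> edges_on E B = edges_on E (A \<inter> B)" by (auto simp: edges_on_def)
  ultimately show ?thesis using card_Un_Int[of "edges_on E A" "edges_on E B"] by simp
qed

text \<open>Induction on the size of the complement. If \<open>X\<close> and the rest of
  \<open>V - T\<close> are not joined, then \<open>T \<union> X\<close> and \<open>V - X\<close>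
  have smaller complements, the same attachments, union \<open>V\<close> and intersection
  \<open>T\<close>. Inclusion and exclusion gives at most 2 (|V| + |T|) - 6 - (2 |V| - 2) = 2 |T| -
  4 edges in \<open>T\<close>, so equality does not arise here.\<close>

lemma bound_two_attachments:
  assumes "T \<subset> V" "a \<in> T" "b \<in> T" "a \<noteq> b"
    and "\<And>y z. y \<in> T \<Longrightarrow> z \<in> V - T \<Longrightarrow> {y, z} \<in> E \<Longrightarrow> y = a \<or> y = b"
  shows "card (edges_on E T) + 3 \<le> 2 * card T \<and>
    (card (edges_on E T) + 3 = 2 * card T \<longrightarrow> biconnected_on E T)"
  using assms
proof (induction "card (V - T)" arbitrary: T rule: less_induct)
  case less
  note T = less.prems(1-4) and bd = less.prems(5)
  show ?case
  proof (cases "connected_on E (V - T)")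
    case True
    then show ?thesis using bound_connected_complement[of T a b] less.prems by blast
  next
    case False
    then obtain X where X: "X \<subseteq> V - T" "X \<noteq> {}" "X \<noteq> V - T"
      and nc: "\<And>u v. u \<in> X \<Longrightarrow> v \<in> V - T - X \<Longrightarrow> {u, v} \<notin> E"
      unfolding connected_on_def by blast
    have nc': "\<And>u v. u \<in> V - T - X \<Longrightarrow> v \<in> X \<Longrightarrow> {u, v} \<notin> E" using nc by (metis insert_commute)
    have sub: "T \<subseteq> V" using T by blast
    \<comment> \<open>Both enlarged sets arise from \<open>V\<close> by removing one of the two
      unjoined parts of \<open>V - T\<close>, so one statement about \<open>V - Y\<close> serves for
      both.\<close>
    have b: "card (edges_on E (V - Y)) + 3 \<le> 2 * card (V - Y)"
      if Y: "Y \<subseteq> V - T" "Y \<noteq> {}" "Y \<noteq> V - T"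
        and ncY: "\<And>u v. u \<in> V - T - Y \<Longrightarrow> v \<in> Y \<Longrightarrow> {u, v} \<notin> E" for Y
    proof (rule less.hyps[THEN conjunct1])
      have "V - (V - Y) \<subset> V - T" using Y by blast
      then show "card (V - (V - Y)) < card (V - T)" using finite_V by (simp add: psubset_card_mono)
      fix y z assume "y \<in> V - Y" "z \<in> V - (V - Y)" "{y, z} \<in> E"
      then show "y = a \<or> y = b" using ncY[of y z] bd[of y z] Y by blast
    qed (use Y T in auto)
    have b1: "card (edges_on E (V - X)) + 3 \<le> 2 * card (V - X)"
      using b[of X] X nc' by blast
    have b2: "card (edges_on E (T \<union> X)) + 3 \<le> 2 * card (T \<union> X)"
    proof -
      have "V - (V - T - X) = T \<union> X" using X sub by blast
      then show ?thesis using b[of "V - T - X"] X nc by force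
    qed
    have "(T \<union> X) \<inter> (V - X) = T" "(T \<union> X) \<union> (V - X) = V" using X sub by blast+
    moreover have "card (edges_on E (T \<union> X)) + card (edges_on E (V - X))
        = card E + card (edges_on E ((T \<union> X) \<inter> (V - X)))"
      by (rule card_edges_on_separation) (use X sub nc in auto)
    moreover have "card (T \<union> X) + card (V - X) = card ((T \<union> X) \<union> (V - X)) + card ((T \<union> X) \<inter> (V - X))"
      using X sub finite_V by (intro card_Un_Int) (auto intro: finite_subset)
    ultimately show ?thesis using b1 b2 spade unfolding spade_on_def by auto
  qed
qed

section \<open>Two-vertex cuts and their absence\<close>

text \<open>The bounds for \<open>A\<close> and \<open>B\<close> add up to 2 (|V| + 2) - 6 = |E|,
  whereas the two edge counts add up to |E| plus the number of edges on \<open>{a, b}\<close>. So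
  both bounds are attained and that number is zero; attaining the bound makes each side
  biconnected.\<close>

lemma split_two_cut:
  assumes AB: "A \<union> B = V" "A \<inter> B = {a, b}" "a \<noteq> b" "A \<noteq> V" "B \<noteq> V"
    and nc: "\<And>u v. u \<in> A - B \<Longrightarrow> v \<in> B - A \<Longrightarrow> {u, v} \<notin> E"
  shows "{a, b} \<notin> E" "biconnected_on E A" "biconnected_on E B"
    "card (edges_on E A) + 3 = 2 * card A" "card (edges_on E B) + 3 = 2 * card B"
proof -
  have nc': "\<And>u v. u \<in> B - A \<Longrightarrow> v \<in> A - B \<Longrightarrow> {u, v} \<notin> E" using nc by (metis insert_commute)
  have A: "card (edges_on E A) + 3 \<le> 2 * card A \<and>
    (card (edges_on E A) + 3 = 2 * card A \<longrightarrow> biconnected_on E A)"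
  proof (rule bound_two_attachments)
    fix y z assume "y \<in> A" "z \<in> V - A" "{y, z} \<in> E"
    then show "y = a \<or> y = b" using nc[of y z] AB by blast
  qed (use AB in auto)
  have B: "card (edges_on E B) + 3 \<le> 2 * card B \<and>
    (card (edges_on E B) + 3 = 2 * card B \<longrightarrow> biconnected_on E B)"
  proof (rule bound_two_attachments)
    fix y z assume "y \<in> B" "z \<in> V - B" "{y, z} \<in> E"
    then show "y = a \<or> y = b" using nc'[of y z] AB by blast
  qed (use AB in auto)
  have "card (edges_on E A) + card (edges_on E B) = card E + card (edges_on E {a, b})"
    using card_edges_on_separation[of A B] AB nc by simp
  moreover have "card A + card B = card V + 2"
    using card_Un_Int[of A B] AB finite_V by (metis card_2_iff finite_Un)
  moreover have "card E + 2 = 2 * card V" using spade unfolding spade_on_def by blast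
  ultimately have *: "card (edges_on E A) + 3 = 2 * card A" "card (edges_on E B) + 3 = 2 * card B"
    "card (edges_on E {a, b}) = 0" using A B by linarith+
  then show "biconnected_on E A" "biconnected_on E B"
    "card (edges_on E A) + 3 = 2 * card A" "card (edges_on E B) + 3 = 2 * card B"
    using A B by blast+
  show "{a, b} \<notin> E" using *(3) by (auto simp: edges_on_def[of E] card_eq_0_iff finite_E)
qed

text \<open>Without a two-vertex cut, deleting any vertex \<open>v\<close> leaves a biconnected set
  whose complement is a single vertex, hence a good flat. It spans 2 (n - 1) - 3 of the 2 n - 2
  edges, so \<open>v\<close> has degree three.\<close>

lemma no_two_cut_K4:
  assumes no_cut: "\<And>a b. a \<in> V \<Longrightarrow> b \<in> V \<Longrightarrow> a \<noteq> b \<Longrightarrow> connected_on E (V - {a, b})"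
  shows "card V = 4" "E = {e. e \<subseteq> V \<and> card e = 2}"
proof -
  have card3: "card V \<ge> 3"
    using spade_card_ge_3 spade bicon unfolding biconnected_on_def by blast
  have cardE: "card E + 2 = 2 * card V" using spade unfolding spade_on_def by blast
  have deg: "card {e \<in> E. v \<in> e} = 3" if v: "v \<in> V" for v
  proof -
    have "biconnected_on E (V - {v})"
      unfolding biconnected_on_def
    proof (intro conjI ballI)
      show "card (V - {v}) \<ge> 2" using card3 v finite_V by simp
      show "connected_on E (V - {v})" using bicon v unfolding biconnected_on_def by blast
      fix w assume "w \<in> V - {v}"
      then have "connected_on E (V - {v, w})" using no_cut[of v w] v by blast
      moreover have "V - {v} - {w} = V - {v, w}" by blast
      ultimately show "connected_on E (V - {v} - {w})" by simp
    qed
    moreover have "V - (V - {v}) = {v}" using v by blast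
    ultimately have "good_on E V (V - {v})" using v unfolding good_on_def by auto
    then have "card (edges_on E (V - {v})) + 3 = 2 * card (V - {v})"
      using spade unfolding spade_on_def by blast
    moreover have "card (V - {v}) + 1 = card V" using v finite_V card3 by simp
    moreover have "E = edges_on E (V - {v}) \<union> {e \<in> E. v \<in> e}"
      using edge_subset unfolding edges_on_def by blast
    then have "card E = card (edges_on E (V - {v})) + card {e \<in> E. v \<in> e}"
      using card_Un_disjoint[of "edges_on E (V - {v})" "{e \<in> E. v \<in> e}"] finite_E
      by (auto simp: edges_on_def)
    ultimately show ?thesis using cardE by linarith
  qed
  \<comment> \<open>Counting incidences twice gives \<open>3 * card V = 2 * card E\<close>. With
    \<open>card E + 2 = 2 * card V\<close> this forces four vertices and six edges, which are all
    the pairs.\<close>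
  have "(\<Sum>v\<in>V. card {e \<in> E. v \<in> e}) = (\<Sum>e\<in>E. card {v \<in> V. v \<in> e})"
    by (rule sum_multicount_gen) (use finite_V finite_E in auto)
  moreover have "{v \<in> V. v \<in> e} = e" if "e \<in> E" for e using edge_subset[OF that] by blast
  ultimately have "3 * card V = 2 * card E" using deg edge_card by (simp add: mult.commute)
  then show c4: "card V = 4" using cardE by linarith
  show "E = {e. e \<subseteq> V \<and> card e = 2}"
  proof (rule card_subset_eq)
    have "(4::nat) choose 2 = 6" by (simp add: choose_two)
    then show "card E = card {e. e \<subseteq> V \<and> card e = 2}"
      using n_subsets[OF finite_V, of 2] c4 cardE by simp
  qed (use finite_V edge_subset edge_card in auto)
qed

end

section \<open>Gluing along an edge that is then removed\<close>

text \<open>A collision with both graphs already placed in one vertex type, sharing exactly the ends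
  of the identified edge. No gluing maps occur, and \<open>swap\<close> makes each one-sided result
  available for the other side.\<close>

locale two_sum = s1: sgraph V1 E1 + s2: sgraph V2 E2
  for V1 :: "'a set" and E1 and V2 :: "'a set" and E2 +
  fixes a b
  assumes V12: "V1 \<inter> V2 = {a, b}" and ab: "a \<noteq> b" and ab1: "{a, b} \<in> E1" and ab2: "{a, b} \<in> E2"
begin

abbreviation "V \<equiv> V1 \<union> V2"
abbreviation "E \<equiv> (E1 \<union> E2) - {{a, b}}"

lemma ab_V [simp]: "a \<in> V1" "a \<in> V2" "b \<in> V1" "b \<in> V2"
  using V12 by auto

lemma swap: "two_sum V2 E2 V1 E1 a b"
  by unfold_locales (use V12 ab ab1 ab2 in auto)

lemma edge12: "e \<in> E1 \<Longrightarrow> e \<in> E2 \<Longrightarrow> e = {a, b}"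
  using s1.edge_subset s2.edge_subset V12 s1.edge_card ab
  by (metis Int_greatest card_2_iff card_subset_eq finite.emptyI finite.insertI)

lemma sgraph_sum: "sgraph V E"
  by unfold_locales
    (use s1.finite_V s2.finite_V s1.edge_subset s2.edge_subset s1.edge_card s2.edge_card in auto)

section \<open>Vertex and edge counts of the sum\<close>

lemma card_V: "card V + 2 = card V1 + card V2"
  using card_Un_Int[of V1 V2] s1.finite_V s2.finite_V V12 ab by simp

lemma edges_on_sum:
  "edges_on E S = (edges_on E1 (S \<inter> V1) - {{a, b}}) \<union> (edges_on E2 (S \<inter> V2) - {{a, b}})"
  unfolding edges_on_def using s1.edge_subset s2.edge_subset by blast

lemma card_edges_on_sum:
  "card (edges_on E S) =
    card (edges_on E1 (S \<inter> V1) - {{a, b}}) + card (edges_on E2 (S \<inter> V2) - {{a, b}})"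
  unfolding edges_on_sum
  by (rule card_Un_disjoint) (auto simp: edges_on_def s1.finite_E s2.finite_E dest: edge12)

lemma card_E: "card E + 2 = card E1 + card E2"
proof -
  have "edges_on E V = E" by (rule sgraph.edges_on_V[OF sgraph_sum])
  moreover have "V \<inter> V1 = V1" "V \<inter> V2 = V2" by auto
  ultimately have "card E = card (E1 - {{a, b}}) + card (E2 - {{a, b}})"
    using card_edges_on_sum[of V] by simp
  moreover have "card (E1 - {{a, b}}) + 1 = card E1" "card (E2 - {{a, b}}) + 1 = card E2"
    using ab1 ab2 s1.finite_E s2.finite_E by (metis Suc_eq_plus1 card.remove)+
  ultimately show ?thesis by linarith
qed

text \<open>A subset of \<open>V1\<close> meets \<open>V2\<close> inside \<open>{a, b}\<close>,
  where the only possible edge of \<open>E2\<close> is the removed one.\<close>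

lemma edges_on_subset:
  assumes "S \<subseteq> V1" shows "edges_on E S = edges_on E1 S - {{a, b}}"
proof -
  have "S \<inter> V1 = S" "S \<inter> V2 \<subseteq> {a, b}" using assms V12 by auto
  moreover have "edges_on E2 (S \<inter> V2) - {{a, b}} = {}"
  proof -
    have "e = {a, b}" if "e \<in> E2" "e \<subseteq> {a, b}" for e
      using s2.edge_card[OF that(1)] that(2) ab by (metis card_2_iff card_subset_eq finite.emptyI finite.insertI)
    then show ?thesis using \<open>S \<inter> V2 \<subseteq> {a, b}\<close> unfolding edges_on_def by blast
  qed
  ultimately show ?thesis unfolding edges_on_sum by auto
qed

section \<open>Connectivity of the sum and of its summands\<close>

text \<open>The edge \<open>{a, b}\<close> of \<open>E1\<close> stands in for any passage through
  \<open>V2\<close>. If a cut of \<open>W \<inter> V1\<close> separates \<open>a\<close> from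
  \<open>b\<close>, this edge crosses it. Otherwise one side avoids both, and all edges of the sum
  at that side belong to \<open>E1\<close>.\<close>

lemma connected_restrict:
  assumes "connected_on E W" "W \<subseteq> V"
  shows "connected_on E1 (W \<inter> V1)"
  unfolding connected_on_def
proof (intro allI impI, rule ccontr)
  fix X assume X: "X \<subseteq> W \<inter> V1" "X \<noteq> {}" "X \<noteq> W \<inter> V1"
    and nc: "\<not> (\<exists>x\<in>X. \<exists>y\<in>W \<inter> V1 - X. {x, y} \<in> E1)"
  have nc': False if "x \<in> W \<inter> V1 - X" "y \<in> X" "{x, y} \<in> E1" for x y
    using nc that by (metis insert_commute)
  have *: "\<exists>x\<in>Z. \<exists>y\<in>W \<inter> V1 - Z. {x, y} \<in> E1"
    if Z: "Z \<subseteq> W \<inter> V1" "Z \<noteq> {}" "Z \<noteq> W \<inter> V1" "a \<notin> Z" "b \<notin> Z" for Z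
  proof -
    obtain x y where xy: "x \<in> Z" "y \<in> W" "y \<notin> Z" "{x, y} \<in> E"
    proof (rule connected_onD[OF assms(1)])
      show "Z \<subseteq> W" "Z \<noteq> {}" "Z \<noteq> W" using Z by auto
    qed
    have "x \<in> V1" "x \<noteq> a" "x \<noteq> b" using xy(1) Z by auto
    then have "x \<notin> V2" using V12 by blast
    then have "{x, y} \<in> E1" using xy(4) s2.edge_subset[of "{x, y}"] by auto
    moreover have "y \<in> V1" using s1.edge_subset[OF \<open>{x, y} \<in> E1\<close>] by blast
    ultimately show ?thesis using xy by blast
  qed
  consider "a \<in> X" "b \<in> W \<inter> V1 - X" | "b \<in> X" "a \<in> W \<inter> V1 - X" | "a \<notin> X" "b \<notin> X"
    | "a \<notin> W \<inter> V1 - X" "b \<notin> W \<inter> V1 - X" by blast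
  then show False
  proof cases
    case 1 then show False using nc ab1 by blast
  next
    case 2 then show False using nc' ab1 by blast
  next
    case 3 then show False using *[of X] X nc by blast
  next
    case 4 then show False using *[of "W \<inter> V1 - X"] X nc' by blast
  qed
qed

text \<open>If \<open>{a, b}\<close> were the only edge across a cut, then its end on the side of a
  third vertex would be a cut vertex.\<close>

lemma connected_minus_edge:
  assumes "biconnected_on E2 V2" "card V2 \<ge> 3"
  shows "connected_on (E2 - {{a, b}}) V2"
  unfolding connected_on_def
proof (intro allI impI, rule ccontr)
  fix X assume X: "X \<subseteq> V2" "X \<noteq> {}" "X \<noteq> V2"
    and nc: "\<not> (\<exists>x\<in>X. \<exists>y\<in>V2 - X. {x, y} \<in> E2 - {{a, b}})"
  have "connected_on E2 V2" using assms(1) unfolding biconnected_on_def by blast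
  then obtain x y where "x \<in> X" "y \<in> V2 - X" "{x, y} \<in> E2"
    using X by (blast elim: connected_onD[of E2 V2 X])
  then have xy: "x \<in> X" "y \<in> V2 - X" "{x, y} = {a, b}" using nc by blast+
  have "V2 \<noteq> {x, y}" using assms(2) ab xy(3) by auto
  then obtain z where z: "z \<in> V2" "z \<noteq> x" "z \<noteq> y" using xy X by blast
  have co: "connected_on E2 (V2 - {x})" "connected_on E2 (V2 - {y})"
    using assms(1) X xy unfolding biconnected_on_def by blast+
  show False
  proof (cases "z \<in> X")
    case True
    obtain u v where "u \<in> X - {x}" "v \<in> V2 - {x}" "v \<notin> X - {x}" "{u, v} \<in> E2"
    proof (rule connected_onD[OF co(1)])
      show "X - {x} \<subseteq> V2 - {x}" "X - {x} \<noteq> {}" "X - {x} \<noteq> V2 - {x}" using X xy z True by auto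
    qed
    moreover have "{u, v} \<noteq> {x, y}" using calculation xy by (auto simp: doubleton_eq_iff)
    ultimately show False using nc xy by auto
  next
    case False
    obtain u v where "u \<in> X" "v \<in> V2 - {y}" "v \<notin> X" "{u, v} \<in> E2"
    proof (rule connected_onD[OF co(2)])
      show "X \<subseteq> V2 - {y}" "X \<noteq> {}" "X \<noteq> V2 - {y}" using X xy z False by auto
    qed
    moreover have "{u, v} \<noteq> {x, y}" using calculation xy by (auto simp: doubleton_eq_iff)
    ultimately show False using nc xy by auto
  qed
qed

text \<open>\<open>V1 - D\<close> is connected with the help of \<open>{a, b}\<close>, and
  \<open>V2 - D\<close> replaces that edge. If \<open>D\<close> misses \<open>V2\<close>, the second
  side stays connected without the edge; if \<open>D\<close> is one of its ends, the edge is gone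
  anyway. The set \<open>D\<close> treats connectedness and the absence of cut vertices
  together.\<close>

lemma connected_sum_delete:
  assumes "biconnected_on E1 V1" "biconnected_on E2 V2" "card V2 \<ge> 3"
    and D: "D = {} \<or> D = {v} \<and> v \<in> V1"
  shows "connected_on E (V - D)"
proof -
  have 1: "connected_on E1 (V1 - D)" using assms unfolding biconnected_on_def by auto
  have 2: "connected_on E (V2 - D)"
  proof (cases "D \<inter> V2 = {}")
    case True
    then have "V2 - D = V2" by blast
    moreover have "connected_on E V2"
      using connected_minus_edge[OF assms(2,3)]
      by (rule connected_on_mono) (auto simp: edges_on_def)
    ultimately show ?thesis by simp
  next
    case False
    then have v: "D = {v}" "v \<in> V2" "v = a \<or> v = b" using D V12 by auto
    then have "connected_on E2 (V2 - D)" using assms(2) unfolding biconnected_on_def by blast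
    then show ?thesis by (rule connected_on_mono) (use v in \<open>auto simp: edges_on_def\<close>)
  qed
  have "V - D = (V1 - D) \<union> (V2 - D)" by blast
  moreover have "connected_on E ((V1 - D) \<union> (V2 - D))"
  proof (rule connected_subst[OF 1 2, where a = a and b = b])
    have "a \<notin> D \<or> b \<notin> D" using D ab by blast
    then show "(V1 - D) \<inter> (V2 - D) \<noteq> {}" using V12 by blast
  qed auto
  ultimately show ?thesis by simp
qed

lemma biconnected_sum:
  assumes "biconnected_on E1 V1" "biconnected_on E2 V2" "card V1 \<ge> 3" "card V2 \<ge> 3"
  shows "biconnected_on E V"
  unfolding biconnected_on_def
proof (intro conjI ballI)
  interpret sw: two_sum V2 E2 V1 E1 a b by (rule swap)
  show "2 \<le> card V" using card_V assms by linarith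
  show "connected_on E V" using connected_sum_delete[of "{}"] assms by simp
  fix v assume "v \<in> V"
  then show "connected_on E (V - {v})"
    using connected_sum_delete[of "{v}" v] sw.connected_sum_delete[of "{v}" v] assms
    by (auto simp: Un_commute)
qed

section \<open>Good flats of the sum\<close>

text \<open>Connectedness of \<open>S\<close>, of \<open>S\<close> minus a vertex and of the
  complement all pass to \<open>V1\<close> by \<open>connected_restrict\<close>. The second
  hypothesis keeps the restriction proper, the third keeps at least two vertices in it.\<close>

lemma good_restrict:
  assumes S: "good_on E V S" "\<not> V1 \<subseteq> S" "{a, b} \<subseteq> S \<or> S \<subseteq> V1"
  shows "good_on E1 V1 (S \<inter> V1)"
proof -
  have bi: "biconnected_on E S" and sub: "S \<subseteq> V" and co: "connected_on E (V - S)"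
    using S unfolding good_on_def by auto
  have fin: "finite (S \<inter> V1)" using s1.finite_V by blast
  have "biconnected_on E1 (S \<inter> V1)"
    unfolding biconnected_on_def
  proof (intro conjI ballI)
    have "card {a, b} \<le> card (S \<inter> V1)" if "{a, b} \<subseteq> S"
      by (rule card_mono[OF fin]) (use that in auto)
    then show "2 \<le> card (S \<inter> V1)"
      using S(3) bi ab unfolding biconnected_on_def by (auto simp: Int_absorb2)
    show "connected_on E1 (S \<inter> V1)"
      using connected_restrict bi sub unfolding biconnected_on_def by blast
    fix v assume v: "v \<in> S \<inter> V1"
    then have "connected_on E1 ((S - {v}) \<inter> V1)"
      using bi sub unfolding biconnected_on_def by (intro connected_restrict) auto
    moreover have "(S - {v}) \<inter> V1 = S \<inter> V1 - {v}" by blast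
    ultimately show "connected_on E1 (S \<inter> V1 - {v})" by simp
  qed
  moreover have "connected_on E1 (V1 - S \<inter> V1)"
  proof -
    have "(V - S) \<inter> V1 = V1 - S \<inter> V1" by blast
    then show ?thesis using connected_restrict[OF co] by auto
  qed
  ultimately show ?thesis using S(2) unfolding good_on_def by blast
qed

text \<open>The removed edge is missing from both sides, and \<open>S\<close> has two vertices fewer
  than the parts together: (2 |S \<inter> V1| - 4) + (2 |V2| - 3) = 2 (|S| + 2) - 7 = 2 |S| -
  3.\<close>

lemma count_containing:
  assumes sp: "spade_on E1 V1" "spade_on E2 V2"
    and S: "good_on E V S" "{a, b} \<subseteq> S" "V2 \<subseteq> S"
  shows "card (edges_on E S) + 3 = 2 * card S"
proof -
  have SV: "S \<subset> V" using S(1) unfolding good_on_def by blast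
  then have "good_on E1 V1 (S \<inter> V1)" using S by (intro good_restrict) auto
  then have c1: "card (edges_on E1 (S \<inter> V1)) + 3 = 2 * card (S \<inter> V1)"
    using sp unfolding spade_on_def by blast
  have c2: "card E2 + 2 = 2 * card V2" using sp unfolding spade_on_def by blast
  have "{a, b} \<in> edges_on E1 (S \<inter> V1)" using S ab1 by (auto simp: edges_on_def)
  then have d1: "card (edges_on E1 (S \<inter> V1) - {{a, b}}) + 1 = card (edges_on E1 (S \<inter> V1))"
    by (metis Suc_eq_plus1 card.remove s1.finite_edges_on)
  have d2: "card (E2 - {{a, b}}) + 1 = card E2"
    by (metis Suc_eq_plus1 card.remove s2.finite_E ab2)
  have "S \<inter> V2 = V2" using S by blast
  then have "card (edges_on E S) = card (edges_on E1 (S \<inter> V1) - {{a, b}}) + card (E2 - {{a, b}})"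
    using card_edges_on_sum[of S] by simp
  moreover have "card S + 2 = card (S \<inter> V1) + card V2"
  proof -
    have "S \<inter> V1 \<union> V2 = S" "S \<inter> V1 \<inter> V2 = {a, b}" using S SV V12 by blast+
    then show ?thesis
      using card_Un_Int[of "S \<inter> V1" V2] s1.finite_V s2.finite_V ab by simp
  qed
  ultimately show ?thesis using c1 c2 d1 d2 by linarith
qed

lemma count_inside:
  assumes sp: "spade_on E1 V1"
    and S: "good_on E V S" "\<not> {a, b} \<subseteq> S" "S \<subseteq> V1"
  shows "card (edges_on E S) + 3 = 2 * card S"
proof -
  have "good_on E1 V1 (S \<inter> V1)" using S by (intro good_restrict) auto
  then have "card (edges_on E1 S) + 3 = 2 * card S"
    using sp S unfolding spade_on_def by (metis Int_absorb2)
  moreover have "{a, b} \<notin> edges_on E1 S" using S by (auto simp: edges_on_def)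
  ultimately show ?thesis using edges_on_subset[OF S(3)] by simp
qed

lemma no_edge_across:
  assumes "x \<in> V1 - V2" "y \<in> V2 - V1" shows "{x, y} \<notin> E" "{y, x} \<notin> E"
  using assms s1.edge_subset s2.edge_subset by blast+

text \<open>A good flat containing \<open>a\<close> and \<open>b\<close> contains all of
  \<open>V1\<close> or all of \<open>V2\<close>, since otherwise its complement falls into two
  unjoined parts. A good flat missing one of them lies on one side: deleting the other costs at most
  one vertex, and what remains is connected but has no edge across.\<close>

lemma spade_sum:
  assumes sp: "spade_on E1 V1" "spade_on E2 V2"
  shows "spade_on E V"
  unfolding spade_on_def
proof (intro conjI allI impI)
  interpret sw: two_sum V2 E2 V1 E1 a b by (rule swap)
  have comm: "E2 \<union> E1 = E1 \<union> E2" "V2 \<union> V1 = V" by blast+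
  show "card E + 2 = 2 * card V" using card_E card_V sp unfolding spade_on_def by linarith
  fix S assume S: "good_on E V S"
  then have sub: "S \<subset> V" and bi: "biconnected_on E S" and co: "connected_on E (V - S)"
    unfolding good_on_def by auto
  show "card (edges_on E S) + 3 = 2 * card S"
  proof (cases "{a, b} \<subseteq> S")
    case True
    have "V1 \<subseteq> S \<or> V2 \<subseteq> S"
    proof (rule ccontr)
      assume "\<not> ?thesis"
      moreover have "V1 - S \<subseteq> V1 - V2" "V2 - S \<subseteq> V2 - V1" using True V12 by blast+
      moreover have "V1 - S \<subseteq> V - S" "V1 - S \<noteq> {}" "V1 - S \<noteq> V - S"
        using calculation by blast+
      then obtain x y where "x \<in> V1 - S" "y \<in> V - S" "y \<notin> V1 - S" "{x, y} \<in> E"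
        by (rule connected_onD[OF co])
      ultimately show False using no_edge_across[of x y] by blast
    qed
    then show ?thesis
      using count_containing[OF sp S True] sw.count_containing[OF sp(2,1)] S True
      by (auto simp: comm)
  next
    case False
    have "S \<subseteq> V1 \<or> S \<subseteq> V2"
    proof (rule ccontr)
      assume n: "\<not> ?thesis"
      define S' where "S' = S - {a, b}"
      have "connected_on E S'"
        by (rule biconnected_onD_less[OF bi]) (use False in \<open>auto simp: S'_def\<close>)
      moreover have "S' - V1 \<noteq> {}" "S' - V1 \<noteq> S'" "S' - V1 \<subseteq> S'"
        using n V12 sub unfolding S'_def by blast+
      ultimately obtain x y where "x \<in> S' - V1" "y \<in> S'" "y \<notin> S' - V1" "{x, y} \<in> E"
        by (metis connected_onD)
      then show False using no_edge_across[of y x] sub V12 unfolding S'_def by blast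
    qed
    then show ?thesis
      using count_inside[OF sp(1) S False] sw.count_inside[OF sp(2)] S False
      by (auto simp: comm)
  qed
qed

section \<open>From the sum back to a summand\<close>

lemma biconnected_summand: "biconnected_on E V1 \<Longrightarrow> biconnected_on E1 V1"
  by (erule biconnected_on_mono) (auto simp: edges_on_subset)

text \<open>Good flats of the summand extend to good flats of the sum: add \<open>V2\<close> if
  \<open>a\<close> and \<open>b\<close> are both present, and keep the set otherwise. In each case
  \<open>V2\<close>, or what is left of it, replaces the missing edge.\<close>

lemma spade_summand:
  assumes sp: "spade_on E V" and bi: "biconnected_on E V1" "biconnected_on E V2"
    and c1: "card (edges_on E V1) + 3 = 2 * card V1"
    and c2: "card (edges_on E V2) + 3 = 2 * card V2"
  shows "spade_on E1 V1"
  unfolding spade_on_def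
proof (intro conjI allI impI)
  interpret sw: two_sum V2 E2 V1 E1 a b by (rule swap)
  have comm: "E2 \<union> E1 = E1 \<union> E2" "V2 \<union> V1 = V" by blast+
  have r1: "card (E1 - {{a, b}}) + 1 = card E1"
    by (metis Suc_eq_plus1 card.remove s1.finite_E ab1)
  \<comment> \<open>Restoring \<open>{a, b}\<close> adds one edge, which turns the deficit 3 of
    \<open>c1\<close> into 2.\<close>
  show "card E1 + 2 = 2 * card V1"
    using r1 c1 edges_on_subset[of V1] by simp
  fix S assume S: "good_on E1 V1 S"
  then have sub: "S \<subset> V1" and biS: "biconnected_on E1 S" and co: "connected_on E1 (V1 - S)"
    unfolding good_on_def by auto
  have sub2: "E1 \<subseteq> insert {a, b} E" by blast
  show "card (edges_on E1 S) + 3 = 2 * card S"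
  proof (cases "{a, b} \<subseteq> S")
    case True
    \<comment> \<open>Deleting one vertex leaves at least one of \<open>a\<close>, \<open>b\<close>,
      so the two parts still overlap and \<open>connected_subst\<close> applies.\<close>
    have bi': "biconnected_on E (S \<union> V2)"
      unfolding biconnected_on_def
    proof (intro conjI ballI)
      have "card {a, b} \<le> card (S \<union> V2)"
        using s1.finite_V s2.finite_V sub by (intro card_mono) (auto intro: finite_subset)
      then show "2 \<le> card (S \<union> V2)" using ab by simp
      show "connected_on E (S \<union> V2)"
      proof (rule connected_subst[OF _ _ _ sub2])
        show "connected_on E1 S" "connected_on E V2"
          using biS bi unfolding biconnected_on_def by blast+
      qed (use True in auto)
      fix v assume "v \<in> S \<union> V2"
      have "connected_on E ((S - {v}) \<union> (V2 - {v}))"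
      proof (rule connected_subst[OF _ _ _ sub2])
        show "connected_on E1 (S - {v})" "connected_on E (V2 - {v})"
          using biS bi unfolding biconnected_on_def by (metis Diff_empty Diff_insert0)+
        show "(S - {v}) \<inter> (V2 - {v}) \<noteq> {}" using True ab V12 by blast
      qed auto
      then show "connected_on E (S \<union> V2 - {v})" by (simp add: Un_Diff)
    qed
    have V1S: "V1 - S \<subseteq> V1 - {a, b}" using True by blast
    have "connected_on E (V1 - S)"
      by (rule connected_on_mono[OF co]) (use V1S in \<open>auto simp: edges_on_def\<close>)
    moreover have "V - (S \<union> V2) = V1 - S" using True V12 by blast
    moreover have "S \<union> V2 \<subset> V" using True V12 sub by blast
    ultimately have "good_on E V (S \<union> V2)" using bi' unfolding good_on_def by simp
    then have c: "card (edges_on E (S \<union> V2)) + 3 = 2 * card (S \<union> V2)"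
      using sp unfolding spade_on_def by blast
    have int: "(S \<union> V2) \<inter> V1 = S" "(S \<union> V2) \<inter> V2 = V2" "S \<inter> V2 = {a, b}"
      using sub V12 True by blast+
    have "card (edges_on E (S \<union> V2)) = card (edges_on E1 S - {{a, b}}) + card (E2 - {{a, b}})"
      using card_edges_on_sum[of "S \<union> V2"] int by simp
    moreover have "card (edges_on E V2) = card (E2 - {{a, b}})"
      using sw.edges_on_subset[of V2] comm by simp
    moreover have "{a, b} \<in> edges_on E1 S" using True ab1 by (auto simp: edges_on_def)
    then have "card (edges_on E1 S - {{a, b}}) + 1 = card (edges_on E1 S)"
      by (metis Suc_eq_plus1 card.remove s1.finite_edges_on)
    moreover have "card (S \<union> V2) + 2 = card S + card V2"
      using card_Un_Int[of S V2] int ab sub s1.finite_V s2.finite_V finite_subset[of S V1] by simp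
    ultimately show ?thesis using c c2 by linarith
  next
    case False
    have bi': "biconnected_on E S"
      by (rule biconnected_on_mono[OF biS]) (use False in \<open>auto simp: edges_on_def\<close>)
    have "connected_on E ((V1 - S) \<union> (V2 - S))"
    proof (rule connected_subst[OF co _ _ sub2])
      show "connected_on E (V2 - S)"
      proof (rule biconnected_onD_less[OF bi(2)])
        have "V2 - (V2 - S) \<subseteq> {a, b} \<inter> S" using sub V12 by blast
        then show "\<forall>x\<in>V2 - (V2 - S). \<forall>y\<in>V2 - (V2 - S). x = y" using False by blast
      qed blast
      show "(V1 - S) \<inter> (V2 - S) \<noteq> {}" using False V12 by blast
    qed auto
    moreover have "(V1 - S) \<union> (V2 - S) = V - S" by blast
    ultimately have "good_on E V S" using bi' sub unfolding good_on_def by auto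
    then have "card (edges_on E S) + 3 = 2 * card S" using sp unfolding spade_on_def by blast
    moreover have "{a, b} \<notin> edges_on E1 S" using False by (auto simp: edges_on_def)
    ultimately show ?thesis using edges_on_subset[of S] sub by simp
  qed
qed

end

section \<open>Relabelling vertices\<close>

lemma edges_on_image:
  assumes "inj_on f V" "S \<subseteq> V" "\<And>e. e \<in> E \<Longrightarrow> e \<subseteq> V"
  shows "edges_on ((`) f ` E) (f ` S) = (`) f ` edges_on E S"
proof -
  have "f ` e \<subseteq> f ` S \<longleftrightarrow> e \<subseteq> S" if "e \<in> E" for e
  proof -
    have "f x \<in> f ` S \<longleftrightarrow> x \<in> S" if "x \<in> e" for x
      using inj_on_image_mem_iff[OF assms(1) _ assms(2), of x] assms(3)[OF \<open>e \<in> E\<close>] that by blast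
    then show ?thesis unfolding image_subset_iff subset_iff[of e] by blast
  qed
  then show ?thesis unfolding edges_on_def by blast
qed

lemma inj_on_image_edges:
  assumes "inj_on f V" "\<And>e. e \<in> E \<Longrightarrow> e \<subseteq> V"
  shows "inj_on ((`) f) E"
  using assms by (meson inj_on_image_Pow inj_on_subset PowI subsetI)

lemma connected_on_image:
  assumes "connected_on E S" shows "connected_on ((`) f ` E) (f ` S)"
  unfolding connected_on_def
proof (intro allI impI)
  fix X assume X: "X \<subseteq> f ` S" "X \<noteq> {}" "X \<noteq> f ` S"
  obtain x y where "x \<in> S \<inter> f -` X" "y \<in> S" "y \<notin> S \<inter> f -` X" "{x, y} \<in> E"
  proof (rule connected_onD[OF assms])
    show "S \<inter> f -` X \<subseteq> S" "S \<inter> f -` X \<noteq> {}" "S \<inter> f -` X \<noteq> S" using X by blast+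
  qed
  moreover from this have "f ` {x, y} \<in> (`) f ` E" by blast
  ultimately have "f x \<in> X" "f y \<in> f ` S - X" "{f x, f y} \<in> (`) f ` E" by auto
  then show "\<exists>x\<in>X. \<exists>y\<in>f ` S - X. {x, y} \<in> (`) f ` E" by blast
qed

lemma biconnected_on_image:
  assumes "biconnected_on E S" "inj_on f S"
  shows "biconnected_on ((`) f ` E) (f ` S)"
  unfolding biconnected_on_def
proof (intro conjI ballI)
  show "2 \<le> card (f ` S)" using assms by (simp add: card_image biconnected_on_def)
  show "connected_on ((`) f ` E) (f ` S)"
    using assms connected_on_image unfolding biconnected_on_def by blast
  fix w assume "w \<in> f ` S"
  then obtain v where v: "v \<in> S" "w = f v" by blast
  then have "f ` S - {w} = f ` (S - {v})"
    using assms(2) by (auto simp: inj_on_def)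
  moreover have "connected_on ((`) f ` E) (f ` (S - {v}))"
    using assms(1) v unfolding biconnected_on_def by (blast intro: connected_on_image)
  ultimately show "connected_on ((`) f ` E) (f ` S - {w})" by simp
qed

lemma image_image_inv_into:
  assumes "inj_on f V" "\<And>e. e \<in> E \<Longrightarrow> e \<subseteq> V"
  shows "(`) (inv_into V f) ` (`) f ` E = E"
proof -
  have "inv_into V f ` f ` e = e" if "e \<in> E" for e
    using assms that by (simp add: inv_into_image_cancel)
  then show ?thesis by (simp add: image_image)
qed

lemma good_on_image:
  assumes f: "inj_on f V" and E: "\<And>e. e \<in> E \<Longrightarrow> e \<subseteq> V" and g: "good_on E V S"
  shows "good_on ((`) f ` E) (f ` V) (f ` S)"
proof -
  have S: "S \<subset> V" "biconnected_on E S" "connected_on E (V - S)" using g unfolding good_on_def by auto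
  have "f ` V - f ` S = f ` (V - S)" using f S(1) by (simp add: inj_on_image_set_diff psubset_imp_subset)
  moreover have "f ` S \<subset> f ` V"
    using f S(1) by (metis image_strict_mono)
  moreover have "inj_on f S" using f S(1) by (meson inj_on_subset psubset_imp_subset)
  ultimately show ?thesis
    using biconnected_on_image[OF S(2), of f] connected_on_image[OF S(3), of f]
    unfolding good_on_def by simp
qed

lemma (in sgraph) sgraph_image:
  assumes f: "inj_on f V" shows "sgraph (f ` V) ((`) f ` E)"
proof unfold_locales
  show "finite (f ` V)" using finite_V by simp
  fix e assume "e \<in> (`) f ` E"
  then obtain d where d: "d \<in> E" "e = f ` d" by blast
  then have "inj_on f d" using f edge_subset by (meson inj_on_subset)
  with d show "e \<subseteq> f ` V" "card e = 2" using edge_subset edge_card by (auto simp: card_image)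
qed

text \<open>A good flat of the image is carried back by the inverse of \<open>f\<close>, to which
  \<open>good_on_image\<close> applies as well; the counts agree by injectivity on vertices and on
  edges.\<close>

lemma (in sgraph) spade_on_image:
  assumes f: "inj_on f V" and sp: "spade_on E V"
  shows "spade_on ((`) f ` E) (f ` V)"
  unfolding spade_on_def
proof (intro conjI allI impI)
  have inj: "inj_on ((`) f) E" by (rule inj_on_image_edges[OF f edge_subset])
  show "card ((`) f ` E) + 2 = 2 * card (f ` V)"
    using sp f inj by (simp add: card_image spade_on_def)
  fix S assume S: "good_on ((`) f ` E) (f ` V) S"
  define g where "g = inv_into V f"
  have g: "inj_on g (f ` V)" "g ` f ` V = V"
    using f by (auto simp: g_def inj_on_inv_into)
  have sub: "S \<subseteq> f ` V" using S unfolding good_on_def by blast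
  then have gS: "g ` S \<subseteq> V" "f ` g ` S = S"
    using g image_inv_into_cancel[OF refl sub] unfolding g_def by blast+
  have gE: "(`) g ` (`) f ` E = E" unfolding g_def by (rule image_image_inv_into[OF f edge_subset])
  have "good_on ((`) g ` (`) f ` E) (g ` f ` V) (g ` S)"
    by (rule good_on_image[OF g(1) _ S]) (use edge_subset in auto)
  then have "good_on E V (g ` S)" using gE g(2) by simp
  then have "card (edges_on E (g ` S)) + 3 = 2 * card (g ` S)"
    using sp unfolding spade_on_def by blast
  moreover have "card (g ` S) = card S" using g(1) sub by (meson card_image inj_on_subset)
  moreover have "edges_on ((`) f ` E) S = (`) f ` edges_on E (g ` S)"
    using edges_on_image[OF f gS(1) edge_subset] gS(2) by simp
  moreover have "card ((`) f ` edges_on E (g ` S)) = card (edges_on E (g ` S))"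
    by (rule card_image, rule inj_on_subset[OF inj]) (auto simp: edges_on_def)
  ultimately show "card (edges_on ((`) f ` E) S) + 3 = 2 * card S" by simp
qed

section \<open>Collisions of copies of the complete graph\<close>

definition sgraph_of :: "'a set \<Rightarrow> 'a set set \<Rightarrow> ('a, 'a set) multigraph" where
  "sgraph_of V E = \<lparr>verts = V, edges = E, ends = (\<lambda>e. e)\<rparr>"

lemma sgraph_of_simps [simp]:
  "verts (sgraph_of V E) = V" "edges (sgraph_of V E) = E" "ends (sgraph_of V E) = (\<lambda>e. e)"
  by (simp_all add: sgraph_of_def)

text \<open>A good flat has two or three vertices, and m choose 2 equals 2 m - 3 for m = 2 and m =
  3.\<close>

lemma complete4_biconnected_spade:
  assumes V: "card V = 4" and E: "E = {e. e \<subseteq> V \<and> card e = 2}"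
  shows "sgraph V E" "biconnected_on E V" "spade_on E V"
proof -
  have fin: "finite V" using V by (metis card.infinite zero_neq_numeral)
  have con: "connected_on E S" if "S \<subseteq> V" for S
    unfolding connected_on_def
  proof (intro allI impI)
    fix X assume X: "X \<subseteq> S" "X \<noteq> {}" "X \<noteq> S"
    then obtain x y where "x \<in> X" "y \<in> S - X" by blast
    moreover from this have "x \<noteq> y" "x \<in> V" "y \<in> V" using X that by blast+
    then have "{x, y} \<in> E" unfolding E by simp
    ultimately show "\<exists>x\<in>X. \<exists>y\<in>S - X. {x, y} \<in> E" by blast
  qed
  show "sgraph V E" by unfold_locales (use fin E in auto)
  show "biconnected_on E V" unfolding biconnected_on_def using con V by auto
  show "spade_on E V" unfolding spade_on_def
  proof (intro conjI allI impI)
    have "(4::nat) choose 2 = 6" by (simp add: choose_two)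
    then show "card E + 2 = 2 * card V" unfolding E using n_subsets[OF fin, of 2] V by simp
    fix S assume "good_on E V S"
    then have S: "S \<subset> V" "card S \<ge> 2" unfolding good_on_def biconnected_on_def by auto
    then have "finite S" "card S < 4" using fin V psubset_card_mono[of V S] finite_subset by auto
    have "edges_on E S = {e. e \<subseteq> S \<and> card e = 2}" using S unfolding E edges_on_def by blast
    then have "card (edges_on E S) = card S choose 2" using n_subsets[OF \<open>finite S\<close>, of 2] by simp
    moreover have "card S = 2 \<or> card S = 3" using S(2) \<open>card S < 4\<close> by auto
    moreover have "(2::nat) choose 2 = 1" "(3::nat) choose 2 = 3" by (simp_all add: choose_two)
    ultimately show "card (edges_on E S) + 3 = 2 * card S" by auto
  qed
qed

text \<open>The two images are simple graphs by injectivity, and the collision conditions say that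
  they share exactly the ends of the identified edge. Collisions thus become instances of
  \<open>two_sum\<close>.\<close>

lemma two_sum_of_collision:
  assumes g1: "sgraph (verts G1) (edges G1)" and g2: "sgraph (verts G2) (edges G2)"
    and c: "is_collision G1 e1 G2 e2 G"
  obtains f1 f2 a b where "inj_on f1 (verts G1)" "inj_on f2 (verts G2)"
    "two_sum (f1 ` verts G1) ((`) f1 ` edges G1) (f2 ` verts G2) ((`) f2 ` edges G2) a b"
    "verts G = f1 ` verts G1 \<union> f2 ` verts G2"
    "edges G = ((`) f1 ` edges G1 \<union> (`) f2 ` edges G2) - {{a, b}}"
proof -
  from c obtain f1 f2 where f: "inj_on f1 (verts G1)" "inj_on f2 (verts G2)" "f1 ` e1 = f2 ` e2"
    "f1 ` verts G1 \<inter> f2 ` verts G2 = f1 ` e1" "verts G = f1 ` verts G1 \<union> f2 ` verts G2"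
    "edges G = ((`) f1 ` edges G1 \<union> (`) f2 ` edges G2) - {f1 ` e1}"
    and e: "e1 \<in> edges G1" "e2 \<in> edges G2"
    unfolding is_collision_def by (elim exE conjE) (rule that)
  have s: "sgraph (f1 ` verts G1) ((`) f1 ` edges G1)" "sgraph (f2 ` verts G2) ((`) f2 ` edges G2)"
    by (rule sgraph.sgraph_image[OF g1 f(1)], rule sgraph.sgraph_image[OF g2 f(2)])
  have "f1 ` e1 \<in> (`) f1 ` edges G1" using e by blast
  then have "card (f1 ` e1) = 2" by (rule sgraph.edge_card[OF s(1)])
  then obtain a b where ab: "f1 ` e1 = {a, b}" "a \<noteq> b" by (rule card_2E)
  have "two_sum (f1 ` verts G1) ((`) f1 ` edges G1) (f2 ` verts G2) ((`) f2 ` edges G2) a b"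
  proof (intro two_sum.intro s two_sum_axioms.intro)
    show "f1 ` verts G1 \<inter> f2 ` verts G2 = {a, b}" using f ab by simp
    show "a \<noteq> b" by (rule ab(2))
    show "{a, b} \<in> (`) f1 ` edges G1" using e ab by (metis imageI)
    show "{a, b} \<in> (`) f2 ` edges G2" using e ab f(3) by (metis imageI)
  qed
  then show ?thesis by (rule that[OF f(1,2) _ f(5)]) (use f(6) ab(1) in simp)
qed

lemma K4_collisions_spade:
  assumes "K4_collisions H"
  shows "sgraph (verts H) (edges H)" "biconnected_on (edges H) (verts H)"
    "spade_on (edges H) (verts H)"
  using assms
proof (induction H rule: K4_collisions.induct)
  case K4
  { case 1 show ?case by (rule complete4_biconnected_spade) (auto simp: K4_def) }
  { case 2 show ?case by (rule complete4_biconnected_spade) (auto simp: K4_def) }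
  { case 3 show ?case by (rule complete4_biconnected_spade) (auto simp: K4_def) }
next
  case (collision G1 G2 e1 e2 G)
  note IH1 = collision.IH(1-3) and IH2 = collision.IH(4-6)
  obtain f1 f2 a b where f: "inj_on f1 (verts G1)" "inj_on f2 (verts G2)"
    and ts: "two_sum (f1 ` verts G1) ((`) f1 ` edges G1) (f2 ` verts G2) ((`) f2 ` edges G2) a b"
    and G: "verts G = f1 ` verts G1 \<union> f2 ` verts G2"
      "edges G = ((`) f1 ` edges G1 \<union> (`) f2 ` edges G2) - {{a, b}}"
    by (rule two_sum_of_collision[OF IH1(1) IH2(1) collision.hyps(3)])
  have s: "sgraph (f1 ` verts G1) ((`) f1 ` edges G1)" "sgraph (f2 ` verts G2) ((`) f2 ` edges G2)"
    by (rule sgraph.sgraph_image[OF IH1(1) f(1)], rule sgraph.sgraph_image[OF IH2(1) f(2)])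
  have b: "biconnected_on ((`) f1 ` edges G1) (f1 ` verts G1)"
    "biconnected_on ((`) f2 ` edges G2) (f2 ` verts G2)"
    by (rule biconnected_on_image[OF IH1(2) f(1)], rule biconnected_on_image[OF IH2(2) f(2)])
  have sp: "spade_on ((`) f1 ` edges G1) (f1 ` verts G1)"
    "spade_on ((`) f2 ` edges G2) (f2 ` verts G2)"
    by (rule sgraph.spade_on_image[OF IH1(1) f(1) IH1(3)],
        rule sgraph.spade_on_image[OF IH2(1) f(2) IH2(3)])
  \<comment> \<open>Neither summand is a single edge, by the edge count; this is the size condition
    of \<open>biconnected_sum\<close>.\<close>
  have c3: "card (f1 ` verts G1) \<ge> 3" "card (f2 ` verts G2) \<ge> 3"
    using sgraph.spade_card_ge_3[OF s(1) sp(1)] sgraph.spade_card_ge_3[OF s(2) sp(2)] b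
    unfolding biconnected_on_def by auto
  { case 1 show ?case unfolding G by (rule two_sum.sgraph_sum[OF ts]) }
  { case 2 show ?case unfolding G by (rule two_sum.biconnected_sum[OF ts b c3]) }
  { case 3 show ?case unfolding G by (rule two_sum.spade_sum[OF ts sp]) }
qed

section \<open>Building a graph by collisions\<close>

lemma obtainable_complete4:
  assumes "card V = 4" "E = {e. e \<subseteq> V \<and> card e = 2}"
  shows "obtainable_from_K4 (sgraph_of V E)"
proof -
  have fin: "finite V" using assms(1) by (metis card.infinite zero_neq_numeral)
  obtain f where f: "bij_betw f {0..<4::nat} V"
    using ex_bij_betw_nat_finite[OF fin] assms(1) by auto
  have "(`) f ` {e. e \<subseteq> {0..<4} \<and> card e = 2} = E"
  proof (intro equalityI subsetI)
    fix e assume "e \<in> (`) f ` {e. e \<subseteq> {0..<4} \<and> card e = 2}"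
    then obtain d where d: "d \<subseteq> {0..<4}" "card d = 2" "e = f ` d" by blast
    then have "card e = 2" using f by (metis bij_betw_def card_image inj_on_subset)
    then show "e \<in> E" using d f assms(2) by (auto simp: bij_betw_def)
  next
    fix e assume "e \<in> E"
    then have e: "e \<subseteq> f ` {0..<4}" "card e = 2" using assms(2) f by (auto simp: bij_betw_def)
    then obtain d where d: "d \<subseteq> {0..<4}" "e = f ` d" by (meson subset_imageE)
    then have "card d = 2" using e f by (metis bij_betw_def card_image inj_on_subset)
    then show "e \<in> (`) f ` {e. e \<subseteq> {0..<4} \<and> card e = 2}" using d by blast
  qed
  then have "isomorphic K4 (sgraph_of V E)"
    unfolding isomorphic_def K4_def using f by auto
  then show ?thesis unfolding obtainable_from_K4_def using K4_collisions.K4 by blast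
qed

text \<open>The summands are known only up to the isomorphisms \<open>g1\<close> and
  \<open>g2\<close>. An injection \<open>h\<close> of the glued vertex set into the natural numbers
  makes \<open>h \<circ> g1\<close> and \<open>h \<circ> g2\<close> the gluing maps of a collision
  in \<open>K4_collisions\<close>, and its inverse leads back.\<close>

lemma obtainable_two_sum:
  assumes ts: "two_sum V1 E1 V2 E2 a b"
    and o1: "obtainable_from_K4 (sgraph_of V1 E1)" and o2: "obtainable_from_K4 (sgraph_of V2 E2)"
  shows "obtainable_from_K4 (sgraph_of (V1 \<union> V2) ((E1 \<union> E2) - {{a, b}}))"
proof -
  interpret two_sum V1 E1 V2 E2 a b by (rule ts)
  obtain H1 g1 where H1: "K4_collisions H1" "bij_betw g1 (verts H1) V1" "E1 = (`) g1 ` edges H1"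
    using o1 unfolding obtainable_from_K4_def isomorphic_def by auto
  obtain H2 g2 where H2: "K4_collisions H2" "bij_betw g2 (verts H2) V2" "E2 = (`) g2 ` edges H2"
    using o2 unfolding obtainable_from_K4_def isomorphic_def by auto
  have "finite V" using s1.finite_V s2.finite_V by blast
  then obtain h :: "'a \<Rightarrow> nat" where h: "inj_on h V"
    using finite_imp_inj_to_nat_seg by meson
  have "{a, b} \<in> (`) g1 ` edges H1" "{a, b} \<in> (`) g2 ` edges H2" using ab1 ab2 H1 H2 by auto
  then obtain e1 e2 where e: "e1 \<in> edges H1" "g1 ` e1 = {a, b}" "e2 \<in> edges H2" "g2 ` e2 = {a, b}"
    by auto
  have v: "(h \<circ> g1) ` verts H1 = h ` V1" "(h \<circ> g2) ` verts H2 = h ` V2"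
    using H1 H2 by (auto simp: bij_betw_def image_comp[symmetric])
  have ed: "(`) (h \<circ> g1) ` edges H1 = (`) h ` E1" "(`) (h \<circ> g2) ` edges H2 = (`) h ` E2"
    unfolding H1 H2 by (auto simp: image_image image_comp)
  have ee: "(h \<circ> g1) ` e1 = h ` {a, b}" "(h \<circ> g2) ` e2 = h ` {a, b}"
    using e by (metis image_comp)+
  have "is_collision H1 e1 H2 e2 (sgraph_of (h ` V) ((`) h ` E))"
    unfolding is_collision_def
  proof (intro conjI e exI)
    show "inj_on (h \<circ> g1) (verts H1)" "inj_on (h \<circ> g2) (verts H2)"
      using H1 H2 h by (auto simp: bij_betw_def intro!: comp_inj_on intro: inj_on_subset)
    show "(h \<circ> g1) ` e1 = (h \<circ> g2) ` e2" using ee by simp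
    show "(h \<circ> g1) ` verts H1 \<inter> (h \<circ> g2) ` verts H2 = (h \<circ> g1) ` e1"
      unfolding v ee V12[symmetric] using inj_on_image_Int[OF h, of V1 V2] by auto
    show "verts (sgraph_of (h ` V) ((`) h ` E)) = (h \<circ> g1) ` verts H1 \<union> (h \<circ> g2) ` verts H2"
      unfolding v by auto
    \<comment> \<open>Injectivity on edges lets the removal of \<open>{a, b}\<close> commute with
      taking images.\<close>
    have "inj_on ((`) h) (E1 \<union> E2)"
      by (rule inj_on_image_edges[OF h]) (use s1.edge_subset s2.edge_subset in blast)
    then have "(`) h ` E = (`) h ` (E1 \<union> E2) - (`) h ` {{a, b}}"
      using ab1 inj_on_image_set_diff[of "(`) h" "E1 \<union> E2" "E1 \<union> E2" "{{a, b}}"] by blast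
    then show "edges (sgraph_of (h ` V) ((`) h ` E)) =
      (\<lambda>e. (h \<circ> g1) ` e) ` edges H1 \<union> (\<lambda>e. (h \<circ> g2) ` e) ` edges H2 - {(h \<circ> g1) ` e1}"
      unfolding ed ee by (simp add: image_Un)
  qed simp
  then have "K4_collisions (sgraph_of (h ` V) ((`) h ` E))"
    by (rule K4_collisions.collision[OF H1(1) H2(1)])
  moreover have "isomorphic (sgraph_of (h ` V) ((`) h ` E)) (sgraph_of V E)"
    unfolding isomorphic_def
  proof (intro exI conjI)
    show "bij_betw (inv_into V h) (verts (sgraph_of (h ` V) ((`) h ` E))) (verts (sgraph_of V E))"
      using h by (simp add: bij_betw_inv_into inj_on_imp_bij_betw)
    have "(`) (inv_into V h) ` (`) h ` E = E"
      by (rule image_image_inv_into[OF h sgraph.edge_subset[OF sgraph_sum]])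
    then show "edges (sgraph_of V E) = (`) (inv_into V h) ` edges (sgraph_of (h ` V) ((`) h ` E))"
      by simp
  qed
  ultimately show ?thesis unfolding obtainable_from_K4_def by blast
qed

lemma spade_obtainable:
  assumes "sgraph V E" "biconnected_on E V" "spade_on E V"
  shows "obtainable_from_K4 (sgraph_of V E)"
  using assms
proof (induction "card V" arbitrary: V E rule: less_induct)
  case less
  interpret spade_graph V E
    by (intro spade_graph.intro spade_graph_axioms.intro less.prems)
  show ?case
  proof (cases "\<exists>a\<in>V. \<exists>b\<in>V. a \<noteq> b \<and> \<not> connected_on E (V - {a, b})")
    case False
    then show ?thesis by (intro obtainable_complete4 no_two_cut_K4) blast+
  next
    case True
    then obtain a b where ab: "a \<in> V" "b \<in> V" "a \<noteq> b" "\<not> connected_on E (V - {a, b})" by blast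
    then obtain X where X: "X \<subseteq> V - {a, b}" "X \<noteq> {}" "X \<noteq> V - {a, b}"
      and nc: "\<And>u v. u \<in> X \<Longrightarrow> v \<in> V - {a, b} - X \<Longrightarrow> {u, v} \<notin> E"
      unfolding connected_on_def by blast
    \<comment> \<open>Both sides keep the cut pair, since \<open>X\<close> avoids \<open>a\<close>
      and \<open>b\<close>.\<close>
    define A B where "A = X \<union> {a, b}" and "B = V - X"
    have AB: "A \<union> B = V" "A \<inter> B = {a, b}" "A \<noteq> V" "B \<noteq> V" "A - B = X" "B - A = V - {a, b} - X"
      using X ab unfolding A_def B_def by blast+
    have split: "{a, b} \<notin> E" "biconnected_on E A" "biconnected_on E B"
      "card (edges_on E A) + 3 = 2 * card A" "card (edges_on E B) + 3 = 2 * card B"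
      using split_two_cut[OF AB(1,2) ab(3) AB(3,4)] nc AB by auto
    \<comment> \<open>The missing edge is added to both sides, so that the collision along it gives
      back \<open>E\<close>.\<close>
    define E1 E2 where "E1 = insert {a, b} (edges_on E A)" and "E2 = insert {a, b} (edges_on E B)"
    have sg: "sgraph C (insert {a, b} (edges_on E C))" if "C \<subseteq> V" "{a, b} \<subseteq> C" for C
    proof unfold_locales
      show "finite C" using that finite_V finite_subset by blast
      fix e assume "e \<in> insert {a, b} (edges_on E C)"
      then show "e \<subseteq> C" "card e = 2" using that ab edge_card by (auto simp: edges_on_def)
    qed
    have sg: "sgraph A E1" "sgraph B E2"
      unfolding E1_def E2_def by (rule sg; use AB in blast)+
    have ts: "two_sum A E1 B E2 a b"
      by (intro two_sum.intro two_sum_axioms.intro sg AB ab) (auto simp: E1_def E2_def)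
    interpret ts: two_sum A E1 B E2 a b by (rule ts)
    have "e \<subseteq> A \<or> e \<subseteq> B" if "e \<in> E" for e
    proof (rule ccontr)
      assume "\<not> ?thesis"
      moreover obtain u v where uv: "e = {u, v}" "{u, v} \<in> E" "{v, u} \<in> E" "u \<in> V" "v \<in> V"
        using edgeE[OF \<open>e \<in> E\<close>] by blast
      ultimately have "u \<in> A - B \<and> v \<in> B - A \<or> v \<in> A - B \<and> u \<in> B - A" using AB(1) by blast
      then show False using nc uv AB by blast
    qed
    then have EE: "(E1 \<union> E2) - {{a, b}} = E"
      using split(1) unfolding E1_def E2_def edges_on_def by blast
    interpret sw: two_sum B E2 A E1 a b by (rule ts.swap)
    have EE': "(E2 \<union> E1) - {{a, b}} = E" "B \<union> A = V" using EE AB by blast+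
    have bi: "biconnected_on E1 A" "biconnected_on E2 B"
      using ts.biconnected_summand sw.biconnected_summand split unfolding EE EE' by blast+
    have sp: "spade_on E1 A"
      using ts.spade_summand split spade AB unfolding EE AB(1) by blast
    have sp': "spade_on E2 B"
      using sw.spade_summand split spade AB unfolding EE' by blast
    have "card A < card V" "card B < card V"
      using AB finite_V by (metis Un_upper1 Un_upper2 psubsetI psubset_card_mono)+
    then have "obtainable_from_K4 (sgraph_of A E1)" "obtainable_from_K4 (sgraph_of B E2)"
      using less.hyps sg bi sp sp' by blast+
    then show ?thesis using obtainable_two_sum[OF ts] unfolding EE AB(1) by blast
  qed
qed

section \<open>From multigraphs to sets of edges\<close>

text \<open>A walk cannot leave a set with no crossing edge, and the vertices reachable from
  \<open>u\<close> form such a set. The hypothesis on ends keeps walks inside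
  \<open>verts M\<close>.\<close>

lemma connected_graph_iff_cut:
  assumes ends: "\<And>e. e \<in> edges M \<Longrightarrow> ends M e \<subseteq> verts M"
  shows "connected_graph M \<longleftrightarrow>
    (\<forall>X\<subseteq>verts M. X \<noteq> {} \<longrightarrow> X \<noteq> verts M \<longrightarrow> (\<exists>x\<in>X. \<exists>y\<in>verts M - X. (x, y) \<in> adj M))"
    (is "_ \<longleftrightarrow> ?R")
proof
  assume con: "connected_graph M"
  show ?R
  proof (intro allI impI, rule ccontr)
    fix X assume X: "X \<subseteq> verts M" "X \<noteq> {}" "X \<noteq> verts M"
      and nc: "\<not> (\<exists>x\<in>X. \<exists>y\<in>verts M - X. (x, y) \<in> adj M)"
    obtain x y where xy: "x \<in> X" "y \<in> verts M - X" using X by blast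
    then have "(x, y) \<in> (adj M)\<^sup>*" using con X unfolding connected_graph_def by blast
    then have "y \<in> X"
    proof (induction rule: rtrancl_induct)
      case (step y z)
      then have "z \<in> verts M" using ends unfolding adj_def by blast
      then show ?case using step nc by blast
    qed (use xy in simp)
    then show False using xy by blast
  qed
next
  assume R: ?R
  show "connected_graph M"
    unfolding connected_graph_def
  proof (intro ballI, rule ccontr)
    fix u v assume uv: "u \<in> verts M" "v \<in> verts M" "(u, v) \<notin> (adj M)\<^sup>*"
    define X where "X = {w \<in> verts M. (u, w) \<in> (adj M)\<^sup>*}"
    have "X \<subseteq> verts M" "X \<noteq> {}" "X \<noteq> verts M" using uv unfolding X_def by blast+
    then obtain x y where xy: "x \<in> X" "y \<in> verts M - X" "(x, y) \<in> adj M" using R by blast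
    then show False unfolding X_def by (blast intro: rtrancl_into_rtrancl)
  qed
qed

lemma connected_graph_induced:
  assumes "ends G = (\<lambda>e. e)"
  shows "connected_graph (induced G S) \<longleftrightarrow> connected_on (edges G) S"
proof -
  have "(x, y) \<in> adj (induced G S) \<longleftrightarrow> {x, y} \<in> edges G" if "x \<in> S" "y \<in> S" for x y
    using that assms by (auto simp: adj_def induced_def edges_in_def)
  then have *: "(\<exists>x\<in>X. \<exists>y\<in>S - X. (x, y) \<in> adj (induced G S)) \<longleftrightarrow>
      (\<exists>x\<in>X. \<exists>y\<in>S - X. {x, y} \<in> edges G)" if "X \<subseteq> S" for X
    using that by (meson DiffD1 subsetD)
  have "verts (induced G S) = S" "\<And>e. e \<in> edges (induced G S) \<Longrightarrow> ends (induced G S) e \<subseteq> S"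
    by (auto simp: induced_def edges_in_def)
  then show ?thesis
    unfolding connected_on_def by (subst connected_graph_iff_cut) (simp_all add: *)
qed

lemma two_connected_induced:
  assumes "ends G = (\<lambda>e. e)"
  shows "two_connected (induced G S) \<longleftrightarrow> biconnected_on (edges G) S"
proof -
  have v: "verts (induced G S) = S" by (simp add: induced_def)
  have "induced (induced G S) (S - {v}) = induced G (S - {v})" for v
    by (auto simp: induced_def edges_in_def)
  then show ?thesis
    unfolding two_connected_def biconnected_on_def cut_vertex_def v
    using connected_graph_induced[OF assms] by auto
qed

lemma induced_verts:
  assumes "simple_graph G" shows "induced G (verts G) = G"
  using assms unfolding simple_graph_def induced_def edges_in_def
  by (cases G) auto

lemma two_connected_iff:
  assumes "simple_graph G"
  shows "two_connected G \<longleftrightarrow> biconnected_on (edges G) (verts G)"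
  using two_connected_induced[of G "verts G"] induced_verts[OF assms] assms
  unfolding simple_graph_def by simp

section \<open>Contracting a connected vertex set\<close>

text \<open>The edges inside \<open>S\<close> join all of the connected set \<open>S\<close> and
  touch no other vertex.\<close>

lemma component_connected_on:
  assumes con: "connected_on (edges G) S" and id: "ends G = (\<lambda>e. e)"
  shows "component G (edges_in G S) v = (if v \<in> S then S else {v})"
proof -
  define M where "M = \<lparr>verts = verts G, edges = edges_in G S, ends = ends G\<rparr>"
  have adj: "adj M = adj (induced G S)" by (simp add: M_def induced_def adj_def)
  have sub: "adj M \<subseteq> S \<times> S" using id by (auto simp: M_def adj_def edges_in_def)
  have stay: "w = v \<or> v \<in> S \<and> w \<in> S" if "(v, w) \<in> (adj M)\<^sup>*" for w
    using that by (induction rule: rtrancl_induct) (use sub in auto)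
  have "(v, w) \<in> (adj M)\<^sup>*" if "v \<in> S" "w \<in> S" for w
    using con that unfolding connected_graph_induced[OF id, symmetric] connected_graph_def adj
    by (simp add: induced_def)
  then show ?thesis using stay unfolding component_def M_def[symmetric] by auto
qed

text \<open>A cut of the union of \<open>U\<close> that splits \<open>S\<close> is crossed because
  \<open>S\<close> is connected. All other cuts are unions of members of \<open>U\<close> and
  correspond to cuts in the contraction.\<close>

lemma connected_graph_contract:
  assumes G: "simple_graph G" and con: "connected_on (edges G) S" and S: "S \<subseteq> verts G"
    and U: "U \<subseteq> verts (contract G (edges_in G S))"
  shows "connected_graph (induced (contract G (edges_in G S)) U) \<longleftrightarrow> connected_on (edges G) (\<Union>U)"
proof -
  have id: "ends G = (\<lambda>e. e)" and E2: "\<And>e. e \<in> edges G \<Longrightarrow> card e = 2 \<and> e \<subseteq> verts G"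
    using G unfolding simple_graph_def by auto
  define c where "c v = (if v \<in> S then S else {v})" for v
  have comp: "component G (edges_in G S) = c"
    using component_connected_on[OF con id] by (auto simp: c_def)
  define C where "C = contract G (edges_in G S)"
  have C: "edges C = edges G - edges_in G S" "ends C = (\<lambda>e. c ` e)"
    by (simp_all add: C_def contract_def comp id)
  define M where "M = induced C U"
  have M: "edges M = {e \<in> edges G - edges_in G S. c ` e \<subseteq> U}" "ends M = (\<lambda>e. c ` e)"
    by (simp_all add: M_def induced_def edges_in_def[of C] C)
  have vM: "verts M = U" by (simp add: M_def induced_def)
  have UC: "U \<subseteq> c ` verts G" using U by (simp add: contract_def comp)
  have cin: "v \<in> c v" for v by (simp add: c_def)
  have cU: "c v = u" if "u \<in> U" "v \<in> u" for u v using that UC by (auto simp: c_def split: if_splits)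
  have cUU: "c v \<in> U" if "v \<in> \<Union>U" for v using that cU by blast
  \<comment> \<open>Different images under \<open>c\<close> mean that the ends do not both lie in
    \<open>S\<close>, so the edge survives the contraction.\<close>
  have adjM: "(c x, c y) \<in> adj M" if "{x, y} \<in> edges G" "x \<in> \<Union>U" "y \<in> \<Union>U" "c x \<noteq> c y" for x y
  proof -
    have "{x, y} \<notin> edges_in G S" using that(4) id by (auto simp: edges_in_def c_def)
    then have "{x, y} \<in> edges M" "ends M {x, y} = {c x, c y}" using that cUU by (auto simp: M)
    then show ?thesis unfolding adj_def by blast
  qed
  have adjM': "\<exists>x\<in>u. \<exists>y\<in>w. {x, y} \<in> edges G" if uw: "(u, w) \<in> adj M" "u \<noteq> w" "u \<in> U" "w \<in> U" for u w
  proof -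
    obtain e where e: "e \<in> edges G" "c ` e = {u, w}"
      using uw(1) unfolding adj_def M by auto
    obtain x y where xy: "e = {x, y}" using E2[OF e(1)] by (auto simp: card_2_iff)
    then have "c x = u \<and> c y = w \<or> c x = w \<and> c y = u" using e by (auto simp: doubleton_eq_iff)
    then show ?thesis using cin e xy by (metis insert_commute)
  qed
  have "connected_graph M \<longleftrightarrow>
    (\<forall>X\<subseteq>U. X \<noteq> {} \<longrightarrow> X \<noteq> U \<longrightarrow> (\<exists>x\<in>X. \<exists>y\<in>U - X. (x, y) \<in> adj M))"
    by (subst connected_graph_iff_cut) (auto simp: vM M)
  also have "\<dots> \<longleftrightarrow> connected_on (edges G) (\<Union>U)"
  proof
    assume L: "\<forall>X\<subseteq>U. X \<noteq> {} \<longrightarrow> X \<noteq> U \<longrightarrow> (\<exists>x\<in>X. \<exists>y\<in>U - X. (x, y) \<in> adj M)"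
    show "connected_on (edges G) (\<Union>U)"
      unfolding connected_on_def
    proof (intro allI impI)
      fix X assume X: "X \<subseteq> \<Union>U" "X \<noteq> {}" "X \<noteq> \<Union>U"
      show "\<exists>x\<in>X. \<exists>y\<in>\<Union>U - X. {x, y} \<in> edges G"
      proof (cases "\<exists>u\<in>U. u \<inter> X \<noteq> {} \<and> \<not> u \<subseteq> X")
        case True
        then obtain u where u: "u \<in> U" "u \<inter> X \<noteq> {}" "\<not> u \<subseteq> X" by blast
        then have "u = S" using UC by (auto simp: c_def split: if_splits)
        obtain x y where "x \<in> S \<inter> X" "y \<in> S" "y \<notin> S \<inter> X" "{x, y} \<in> edges G"
        proof (rule connected_onD[OF con])
          show "S \<inter> X \<subseteq> S" "S \<inter> X \<noteq> {}" "S \<inter> X \<noteq> S" using u \<open>u = S\<close> by blast+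
        qed
        then show ?thesis using u \<open>u = S\<close> by blast
      next
        case False
        \<comment> \<open>No member of \<open>U\<close> is split by \<open>X\<close>, so
          \<open>X\<close> is the union of \<open>X'\<close>.\<close>
        define X' where "X' = {u \<in> U. u \<subseteq> X}"
        have cX: "c v \<in> X'" if "v \<in> X" for v
        proof -
          have "c v \<in> U" using cUU X that by blast
          then show ?thesis using False cin[of v] that unfolding X'_def by blast
        qed
        obtain p where "p \<in> X" using X by blast
        then have "X' \<noteq> {}" using cX by blast
        obtain q where "q \<in> \<Union>U" "q \<notin> X" using X by blast
        then have "c q \<in> U - X'" using cUU cin[of q] unfolding X'_def by blast
        then have "X' \<subseteq> U" "X' \<noteq> U" unfolding X'_def by auto
        then obtain u w where uw: "u \<in> X'" "w \<in> U - X'" "(u, w) \<in> adj M"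
          using L \<open>X' \<noteq> {}\<close> by meson
        then obtain x y where "x \<in> u" "y \<in> w" "{x, y} \<in> edges G"
          using adjM'[of u w] unfolding X'_def by blast
        moreover have "y \<notin> X" using cX[of y] cU[of w y] uw calculation by blast
        ultimately show ?thesis using uw unfolding X'_def by blast
      qed
    qed
  next
    assume R: "connected_on (edges G) (\<Union>U)"
    show "\<forall>X\<subseteq>U. X \<noteq> {} \<longrightarrow> X \<noteq> U \<longrightarrow> (\<exists>x\<in>X. \<exists>y\<in>U - X. (x, y) \<in> adj M)"
    proof (intro allI impI)
      fix X assume X: "X \<subseteq> U" "X \<noteq> {}" "X \<noteq> U"
      have ne: "u \<noteq> {}" if "u \<in> U" for u using UC that cin by blast
      obtain p q where pq: "p \<in> X" "q \<in> U" "q \<notin> X" using X by blast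
      obtain r where r: "r \<in> q" using ne pq by blast
      have "r \<notin> \<Union>X" using cU[of q r] r pq X cU by blast
      obtain x y where xy: "x \<in> \<Union>X" "y \<in> \<Union>U" "y \<notin> \<Union>X" "{x, y} \<in> edges G"
      proof (rule connected_onD[OF R])
        show "\<Union>X \<subseteq> \<Union>U" using X by blast
        show "\<Union>X \<noteq> {}" using ne pq X by blast
        show "\<Union>X \<noteq> \<Union>U" using \<open>r \<notin> \<Union>X\<close> r pq by blast
      qed
      have "c x \<in> X" using xy cU X by blast
      moreover have "c y \<in> U - X" using xy cUU cin[of y] by blast
      moreover have "x \<in> \<Union>U" using xy(1) X(1) by blast
      moreover have "c x \<noteq> c y" using calculation by auto
      ultimately have "(c x, c y) \<in> adj M" using adjM[OF xy(4)] xy(2) by blast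
      then show "\<exists>x\<in>X. \<exists>y\<in>U - X. (x, y) \<in> adj M"
        using \<open>c x \<in> X\<close> \<open>c y \<in> U - X\<close> by blast
    qed
  qed
  finally show ?thesis unfolding M_def C_def .
qed

text \<open>Deleting a vertex \<open>{v}\<close> outside \<open>S\<close> leaves a contraction of
  the graph without \<open>v\<close>, which is connected. So only the vertex \<open>S\<close> can be
  a cut vertex, and deleting it leaves \<open>verts G - S\<close>.\<close>

lemma two_connected_contract:
  assumes G: "simple_graph G" and bi: "biconnected_on (edges G) (verts G)"
    and con: "connected_on (edges G) S" and S: "S \<subset> verts G" "S \<noteq> {}"
  shows "two_connected (contract G (edges_in G S)) \<longleftrightarrow> connected_on (edges G) (verts G - S)"
proof -
  have id: "ends G = (\<lambda>e. e)" and fin: "finite (verts G)"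
    using G unfolding simple_graph_def by auto
  define C where "C = contract G (edges_in G S)"
  have vC: "verts C = insert S ((\<lambda>v. {v}) ` (verts G - S))"
    using S component_connected_on[OF con id] by (auto simp: C_def contract_def image_iff)
  have UC: "\<Union>(verts C) = verts G" unfolding vC using S by auto
  have conC: "connected_graph (induced C U) \<longleftrightarrow> connected_on (edges G) (\<Union>U)" if "U \<subseteq> verts C" for U
    using connected_graph_contract[OF G con _ that[unfolded C_def]] S unfolding C_def by blast
  have "induced C (verts C) = C"
    using G by (auto simp: C_def induced_def edges_in_def contract_def simple_graph_def)
  then have "connected_graph C"
    using conC[of "verts C"] UC bi unfolding biconnected_on_def by simp
  moreover have "card (verts C) \<ge> 2"
  proof -
    obtain v where "v \<in> verts G - S" using S by blast
    then have "{S, {v}} \<subseteq> verts C" "S \<noteq> {v}" unfolding vC by auto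
    moreover have "finite (verts C)" unfolding vC using fin by simp
    ultimately show ?thesis by (metis card_2_iff card_mono)
  qed
  moreover have "\<not> cut_vertex C {v}" if "v \<notin> S" for v
  proof -
    have "verts C - {{v}} = insert S ((\<lambda>x. {x}) ` (verts G - S - {v}))"
      unfolding vC using that by auto
    then have U: "\<Union>(verts C - {{v}}) = verts G - {v}" using that S by auto
    have "connected_on (edges G) (verts G - {v})"
      using bi unfolding biconnected_on_def by (cases "v \<in> verts G") auto
    then show ?thesis using conC[OF Diff_subset, of "{{v}}"] unfolding cut_vertex_def U by blast
  qed
  moreover have "cut_vertex C S \<longleftrightarrow> \<not> connected_on (edges G) (verts G - S)"
  proof -
    have "\<Union>(verts C - {S}) = verts G - S" unfolding vC by auto
    moreover have "S \<in> verts C" unfolding vC by blast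
    ultimately show ?thesis using conC[OF Diff_subset, of "{S}"] unfolding cut_vertex_def by simp
  qed
  moreover have "v = S \<or> (\<exists>w. w \<notin> S \<and> v = {w})" if "cut_vertex C v" for v
    using that unfolding cut_vertex_def vC by auto
  ultimately show ?thesis unfolding two_connected_def C_def[symmetric] by blast
qed

lemma good_flat_iff:
  assumes G: "simple_graph G" and bi: "biconnected_on (edges G) (verts G)"
  shows "good_flat G S \<longleftrightarrow> good_on (edges G) (verts G) S"
proof -
  have id: "ends G = (\<lambda>e. e)" using G unfolding simple_graph_def by auto
  have "connected_on (edges G) S" "S \<noteq> {}" if "biconnected_on (edges G) S"
    using that unfolding biconnected_on_def by auto
  then show ?thesis
    unfolding good_flat_def good_on_def two_connected_induced[OF id]
    using two_connected_contract[OF G bi] by blast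
qed

lemma spade2_iff:
  assumes G: "simple_graph G" and bi: "biconnected_on (edges G) (verts G)"
  shows "spade2 G \<longleftrightarrow> spade_on (edges G) (verts G)"
proof -
  have "edges_in G S = edges_on (edges G) S" for S
    using G unfolding simple_graph_def edges_in_def edges_on_def by auto
  moreover have "int m = 2 * (int n - 1) \<longleftrightarrow> m + 2 = 2 * n" for m n by auto
  moreover have "int m = 2 * int n - 3 \<longleftrightarrow> m + 3 = 2 * n" for m n by auto
  ultimately show ?thesis unfolding spade2_def spade_on_def good_flat_iff[OF assms] by simp
qed

theorem theorem5p3:
  fixes G :: "('a, 'a set) multigraph"
  assumes "simple_graph G" and "two_connected G"
  shows "spade2 G \<longleftrightarrow> obtainable_from_K4 G"
proof -
  have bi: "biconnected_on (edges G) (verts G)"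
    using assms two_connected_iff by blast
  have sg: "sgraph (verts G) (edges G)"
    by unfold_locales (use assms(1) in \<open>auto simp: simple_graph_def\<close>)
  have G: "G = sgraph_of (verts G) (edges G)"
    using assms(1) by (cases G) (simp add: sgraph_of_def simple_graph_def)
  have "spade_on (edges G) (verts G)" if ob: "obtainable_from_K4 G"
  proof -
    obtain H f where H: "K4_collisions H" "bij_betw f (verts H) (verts G)"
      "edges G = (`) f ` edges H"
      using ob unfolding obtainable_from_K4_def isomorphic_def by auto
    then have f: "inj_on f (verts H)" "f ` verts H = verts G" by (auto simp: bij_betw_def)
    show ?thesis
      using sgraph.spade_on_image[OF K4_collisions_spade(1)[OF H(1)] f(1) K4_collisions_spade(3)[OF H(1)]]
      unfolding f(2) H(3) .
  qed
  moreover have "obtainable_from_K4 G" if "spade_on (edges G) (verts G)"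
    using spade_obtainable[OF sg bi that] G by simp
  ultimately show ?thesis using spade2_iff[OF assms(1) bi] by blast
qed

end
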